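(* Let $\Omega\subset\mathbb{R}^n$ be open, bounded and connected, let $v$ be a weight on $\Omega$, and let $Q$ be a matrix function on $\Omega$. Suppose there is a constant $C>0$ such that the Sobolev inequality without gain $$\Big(\int_\Omega|\varphi|^2\,v\,dx\Big)^{1/2}\le C\Big(\int_\Omega|\sqrt Q\,\nabla\varphi|^2\,dx\Big)^{1/2}$$ holds for all $\varphi\in \mathrm{Lip}_0(\Omega)$. Let $f,h\in L^2(v,\Omega)$ and let $\mathbf e:\Omega\to\mathbb{R}^n$ be measurable and such that for a.e. $x\in\Omega$ and all $\xi\in\mathbb{R}^n$, $\langle\mathbf e(x),\xi\rangle^2\le v(x)^{-1}\langle Q(x)\xi,\xi\rangle$. Then the Dirichlet problem $$-v^{-1}\operatorname{div}(Q\nabla u)=f+v^{-1}\operatorname{div}(v\mathbf e h)\ \text{in }\Omega,\qquad u=0\ \text{on }\partial\Omega,$$ has a unique degenerate weak solution $u=(u,\nabla u)\in QH^{1,2}_0(v,\Omega)$; in particular it satisfies $$\int_\Omega|u|^2\,v\,dx+\int_\Omega|\sqrt Q\,\nabla u|^2\,dx<\infty .$$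
   Context: A weight is a nonnegative measurable function $v$ with $0<v(x)<\infty$ a.e. A matrix function $Q$ on $\Omega$ is a map whose values are real, symmetric, positive semidefinite $n\times n$ matrices, with measurable entries that are finite a.e., and with $Q(x)$ invertible for a.e. $x$; $\sqrt Q$ is the positive semidefinite square root. $L^2(v,\Omega)$ has norm $\|f\|_{L^2(v,\Omega)}=(\int_\Omega|f|^2v\,dx)^{1/2}$. $QL^2(\Omega)$ is the space of measurable $\mathbf f:\Omega\to\mathbb{R}^n$ with $\|\mathbf f\|_{QL^2(\Omega)}=(\int_\Omega|\sqrt Q\mathbf f|^2dx)^{1/2}<\infty$. $\mathrm{Lip}_0(\Omega)$ is the set of Lipschitz functions with compact support in $\Omega$. $Q\mathrm{Lip}_0(v,\Omega)$ is the set of $\varphi\in\mathrm{Lip}_0(\Omega)$ with $\|\varphi\|_{L^2(v,\Omega)}+\|\nabla\varphi\|_{QL^2(\Omega)}<\infty$ (assumed nontrivial). $QH^{1,2}_0(v,\Omega)$ is the closure of $\{(\varphi,\nabla\varphi):\varphi\in Q\mathrm{Lip}_0(v,\Omega)\}$ in $L^2(v,\Omega)\oplus QL^2(\Omega)$. Its elements are pairs $(u,\mathbf g)$; one writes $\nabla u:=\mathbf g$ by convention, although $\mathbf g$ need not be a weak derivative of $u$ nor be determined by $u$, and one often writes just $u$ for the pair. A degenerate weak solution of the problem is a pair $(u,\nabla u)\in QH^{1,2}_0(v,\Omega)$ such that for all $\varphi\in Q\mathrm{Lip}_0(v,\Omega)$, $$\int_\Omega Q\nabla u\cdot\nabla\varphi\,dx=\int_\Omega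 f\varphi\,v\,dx-\int_\Omega h\,\mathbf e\cdot\nabla\varphi\,v\,dx .$$ *)

theory Defs
  imports "HOL-Analysis.Analysis"
begin

text \<open>
  Functions on \<open>\<Omega>\<close> are total functions whose values outside \<open>\<Omega>\<close> are irrelevant, and
  "measurable" and "a.e." refer to Lebesgue measure on \<open>\<Omega>\<close>. Weights and matrix functions are
  real valued, so the requirement that they be finite is part of the type.
\<close>

definition weight :: "(real^'n) set \<Rightarrow> (real^'n \<Rightarrow> real) \<Rightarrow> bool" where
  "weight \<Omega> v \<longleftrightarrow>
     v \<in> borel_measurable (lebesgue_on \<Omega>) \<and> (\<forall>x\<in>\<Omega>. 0 \<le> v x) \<and> (AE x in lebesgue_on \<Omega>. 0 < v x)"

definition psd_matrix :: "real^'n^'n \<Rightarrow> bool" where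
  "psd_matrix A \<longleftrightarrow> transpose A = A \<and> (\<forall>\<xi>. 0 \<le> (A *v \<xi>) \<bullet> \<xi>)"

definition matrix_sqrt :: "real^'n^'n \<Rightarrow> real^'n^'n" where
  "matrix_sqrt A = (THE B. psd_matrix B \<and> B ** B = A)"

definition matrix_function :: "(real^'n) set \<Rightarrow> (real^'n \<Rightarrow> real^'n^'n) \<Rightarrow> bool" where
  "matrix_function \<Omega> Q \<longleftrightarrow>
     (\<forall>x\<in>\<Omega>. psd_matrix (Q x)) \<and>
     (\<forall>i j. (\<lambda>x. Q x $ i $ j) \<in> borel_measurable (lebesgue_on \<Omega>)) \<and>
     (AE x in lebesgue_on \<Omega>. invertible (Q x))"

text \<open>Norms take values in \<open>[0, \<infinity>]\<close>.\<close>

definition ennreal_sqrt :: "ennreal \<Rightarrow> ennreal" where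
  "ennreal_sqrt t = (if t = \<infinity> then \<infinity> else ennreal (sqrt (enn2real t)))"

definition norm_L2 :: "(real^'n \<Rightarrow> real) \<Rightarrow> (real^'n) set \<Rightarrow> (real^'n \<Rightarrow> real) \<Rightarrow> ennreal" where
  "norm_L2 v \<Omega> f = ennreal_sqrt (\<integral>\<^sup>+ x. ennreal (\<bar>f x\<bar>\<^sup>2 * v x) \<partial>lebesgue_on \<Omega>)"

definition norm_QL2 ::
    "(real^'n \<Rightarrow> real^'n^'n) \<Rightarrow> (real^'n) set \<Rightarrow> (real^'n \<Rightarrow> real^'n) \<Rightarrow> ennreal" where
  "norm_QL2 Q \<Omega> g =
     ennreal_sqrt (\<integral>\<^sup>+ x. ennreal ((norm (matrix_sqrt (Q x) *v g x))\<^sup>2) \<partial>lebesgue_on \<Omega>)"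

definition L2 :: "(real^'n \<Rightarrow> real) \<Rightarrow> (real^'n) set \<Rightarrow> (real^'n \<Rightarrow> real) set" where
  "L2 v \<Omega> = {f \<in> borel_measurable (lebesgue_on \<Omega>). norm_L2 v \<Omega> f < \<infinity>}"

definition QL2 ::
    "(real^'n \<Rightarrow> real^'n^'n) \<Rightarrow> (real^'n) set \<Rightarrow> (real^'n \<Rightarrow> real^'n) set" where
  "QL2 Q \<Omega> = {g \<in> borel_measurable (lebesgue_on \<Omega>). norm_QL2 Q \<Omega> g < \<infinity>}"

definition Lip0 :: "(real^'n) set \<Rightarrow> (real^'n \<Rightarrow> real) set" where
  "Lip0 \<Omega> = {\<phi>. (\<exists>L. L-lipschitz_on \<Omega> \<phi>) \<and>
     compact (closure {x\<in>\<Omega>. \<phi> x \<noteq> 0}) \<and> closure {x\<in>\<Omega>. \<phi> x \<noteq> 0} \<subseteq> \<Omega>}"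

text \<open>
  The gradient of a Lipschitz function is defined a.e. only (it exists a.e. by Rademacher's theorem),
  so it is treated as a relation: \<open>G\<close> is a representative of \<open>\<nabla>\<phi>\<close> if it is the classical gradient of
  \<open>\<phi>\<close> at almost every point. Any two representatives agree a.e.
\<close>

definition ae_gradient ::
    "(real^'n) set \<Rightarrow> (real^'n \<Rightarrow> real) \<Rightarrow> (real^'n \<Rightarrow> real^'n) \<Rightarrow> bool" where
  "ae_gradient \<Omega> \<phi> G \<longleftrightarrow> (AE x in lebesgue_on \<Omega>. GDERIV \<phi> x :> G x)"

text \<open>The set of pairs \<open>(\<phi>, \<nabla>\<phi>)\<close> with \<open>\<phi> \<in> QLip\<^sub>0(v, \<Omega>)\<close>.\<close>

definition QLip0_pairs ::
    "(real^'n \<Rightarrow> real) \<Rightarrow> (real^'n \<Rightarrow> real^'n^'n) \<Rightarrow> (real^'n) set \<Rightarrow>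
      ((real^'n \<Rightarrow> real) \<times> (real^'n \<Rightarrow> real^'n)) set" where
  "QLip0_pairs v Q \<Omega> = {(\<phi>, G). \<phi> \<in> Lip0 \<Omega> \<and> ae_gradient \<Omega> \<phi> G \<and>
     norm_L2 v \<Omega> \<phi> + norm_QL2 Q \<Omega> G < \<infinity>}"

text \<open>
  The closure of these pairs in \<open>L\<^sup>2(v, \<Omega>) \<oplus> QL\<^sup>2(\<Omega>)\<close>. The topology is that of a seminorm on
  functions, and the resulting set is closed under changes on null sets. The sum of the two norms
  is equivalent to the Hilbert space norm on the direct sum.
\<close>

definition QH0 ::
    "(real^'n \<Rightarrow> real) \<Rightarrow> (real^'n \<Rightarrow> real^'n^'n) \<Rightarrow> (real^'n) set \<Rightarrow>
      ((real^'n \<Rightarrow> real) \<times> (real^'n \<Rightarrow> real^'n)) set" where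
  "QH0 v Q \<Omega> = {(u, g). u \<in> L2 v \<Omega> \<and> g \<in> QL2 Q \<Omega> \<and>
     (\<forall>\<epsilon>>0. \<exists>(\<phi>, G) \<in> QLip0_pairs v Q \<Omega>.
        norm_L2 v \<Omega> (\<lambda>x. u x - \<phi> x) + norm_QL2 Q \<Omega> (\<lambda>x. g x - G x) < ennreal \<epsilon>)}"

text \<open>
  In a pair \<open>(u, g)\<close> the second component plays the role of \<open>\<nabla>u\<close>. If \<open>f\<close> and \<open>h\<close> are in
  \<open>L\<^sup>2(v, \<Omega>)\<close> and \<open>(e \<bullet> \<xi>)\<^sup>2 \<le> v\<inverse> Q\<xi> \<bullet> \<xi>\<close> a.e., then all three integrands are integrable.
\<close>

definition degenerate_weak_solution ::
    "(real^'n) set \<Rightarrow> (real^'n \<Rightarrow> real) \<Rightarrow> (real^'n \<Rightarrow> real^'n^'n) \<Rightarrow> (real^'n \<Rightarrow> real) \<Rightarrow>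
      (real^'n \<Rightarrow> real) \<Rightarrow> (real^'n \<Rightarrow> real^'n) \<Rightarrow>
      (real^'n \<Rightarrow> real) \<Rightarrow> (real^'n \<Rightarrow> real^'n) \<Rightarrow> bool" where
  "degenerate_weak_solution \<Omega> v Q f h e u g \<longleftrightarrow>
     (u, g) \<in> QH0 v Q \<Omega> \<and>
     (\<forall>(\<phi>, G) \<in> QLip0_pairs v Q \<Omega>.
        (LINT x|lebesgue_on \<Omega>. (Q x *v g x) \<bullet> G x) =
        (LINT x|lebesgue_on \<Omega>. f x * \<phi> x * v x)
          - (LINT x|lebesgue_on \<Omega>. h x * (e x \<bullet> G x) * v x))"

end

theory Submission
  imports Defs
begin

text \<open>
  The problem is variational. Write \<open>a\<close> for the form \<open>\<integral> Q g \<bullet> g'\<close> and \<open>F\<close> for the right-hand side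
  \<open>\<integral> f \<phi> v - \<integral> h (e \<bullet> \<nabla>\<phi>) v\<close>. By the hypothesis on \<open>e\<close> and the arithmetic-geometric mean inequality
  \<open>F\<close> is bounded by \<open>\<parallel>f\<parallel>\<^sup>2 + \<parallel>h\<parallel>\<^sup>2 + \<parallel>\<phi>\<parallel>\<^sup>2 + a(\<nabla>\<phi>, \<nabla>\<phi>)\<close>, and the Sobolev inequality absorbs
  \<open>\<parallel>\<phi>\<parallel>\<^sup>2\<close> into \<open>a(\<nabla>\<phi>, \<nabla>\<phi>)\<close>. As \<open>F\<close> is linear and \<open>a\<close> quadratic, applying this to a suitable multiple
  of \<open>\<phi>\<close> shows that the energy \<open>a(\<nabla>\<phi>, \<nabla>\<phi>) - 2 F(\<phi>)\<close> is bounded below on test functions.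

  A minimising sequence of this energy is automatically Cauchy for \<open>a\<close>, and its first variations tend
  to zero (\<open>minimising_sequence\<close>). By the Sobolev inequality it is Cauchy in
  \<open>L\<^sup>2(v) \<oplus> QL\<^sup>2\<close> as well. This space is complete by a Riesz--Fischer argument (\<open>form_L2_complete\<close>),
  and the limit is a weak solution (\<open>weak_solution_exists\<close>). The difference of two weak solutions is
  \<open>a\<close>-orthogonal to all test functions, hence to itself; the Sobolev inequality, which survives
  passage to the closure, then kills its first component too (\<open>weak_solution_unique\<close>).

  A pair \<open>(u, g)\<close> is treated as one function \<open>x \<mapsto> (u x, g x)\<close> with values in \<open>\<real> \<times> \<real>\<^sup>n\<close>, and both
  norms as integrals of pointwise positive semidefinite forms: \<open>v s s'\<close> and \<open>Q \<xi> \<bullet> \<xi>'\<close>. The second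
  description uses \<open>|\<surd>Q \<xi>|\<^sup>2 = Q \<xi> \<bullet> \<xi>\<close>, so that the measurability of \<open>\<surd>Q\<close> never arises; it rests on
  existence and uniqueness of the square root (\<open>norm_matrix_sqrt_mult\<close>).
\<close>

section \<open>Symmetric positive definite matrices and their square roots\<close>

text \<open>
  The source of every Cauchy--Schwarz inequality below, and of the estimate for first variations along
  a minimising sequence.
\<close>
lemma discriminant_bound:
  fixes a b c :: real
  assumes "\<And>t. 0 \<le> a + 2 * t * b + t\<^sup>2 * c" and "0 \<le> c"
  shows "b\<^sup>2 \<le> a * c"
proof (cases "c = 0")
  case True
  have "b = 0"
  proof (rule ccontr)
    assume "b \<noteq> 0"
    then show False
      using assms(1)[of "- (a + 1) / (2 * b)"] True by (simp add: field_simps)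
  qed
  then show ?thesis using True by simp
next
  case False
  then show ?thesis
    using assms(1)[of "- b / c"] assms(2) by (simp add: field_simps power2_eq_square)
qed

lemma psd_bilinear_cauchy_schwarz:
  fixes B :: "'b::real_vector \<Rightarrow> 'b \<Rightarrow> real"
  assumes "bilinear B" and "\<And>y z. B y z = B z y" and "\<And>y. 0 \<le> B y y"
  shows "(B y z)\<^sup>2 \<le> B y y * B z z"
proof (rule discriminant_bound)
  fix t :: real
  have "0 \<le> B (y + t *\<^sub>R z) (y + t *\<^sub>R z)" by (rule assms)
  then show "0 \<le> B y y + 2 * t * B y z + t\<^sup>2 * B z z"
    using assms(2)[of z y]
    by (simp add: bilinear_ladd[OF assms(1)] bilinear_radd[OF assms(1)]
        bilinear_lmul[OF assms(1)] bilinear_rmul[OF assms(1)] power2_eq_square algebra_simps)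
qed (rule assms)

text \<open>
  The constant is the minimum over the unit sphere.
\<close>
lemma posdef_bilinear_coercive:
  fixes B :: "'b::euclidean_space \<Rightarrow> 'b \<Rightarrow> real"
  assumes bil: "bilinear B" and pos: "\<And>y. y \<noteq> 0 \<Longrightarrow> 0 < B y y"
  obtains c where "0 < c" and "\<And>y. c * (norm y)\<^sup>2 \<le> B y y"
proof -
  have cont: "continuous_on (sphere 0 1) (\<lambda>y. B y y)"
    by (rule bilinear_continuous_on_compose[OF continuous_on_id continuous_on_id bil])
  have "sphere (0::'b) 1 \<noteq> {}" by simp
  then obtain y0 where y0: "y0 \<in> sphere 0 1" "\<And>y. y \<in> sphere 0 1 \<Longrightarrow> B y0 y0 \<le> B y y"
    using continuous_attains_inf[OF compact_sphere _ cont] by blast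
  have "0 < B y0 y0" using y0(1) by (intro pos) auto
  moreover have "B y0 y0 * (norm y)\<^sup>2 \<le> B y y" for y
  proof (cases "y = 0")
    case True
    then show ?thesis using bilinear_lzero[OF bil] by simp
  next
    case False
    have "B y0 y0 \<le> B ((1 / norm y) *\<^sub>R y) ((1 / norm y) *\<^sub>R y)"
      using False by (intro y0(2)) simp
    also have "\<dots> = B y y / (norm y)\<^sup>2"
      by (simp add: bilinear_lmul[OF bil] bilinear_rmul[OF bil] power2_eq_square)
    finally show ?thesis using False by (simp add: field_simps)
  qed
  ultimately show thesis by (rule that)
qed

lemma bilinear_matrix_form: "bilinear (\<lambda>x y. (A *v x) \<bullet> (y :: real^'n))"
  by (auto simp: bilinear_def linear_iff matrix_vector_right_distrib inner_add_left inner_add_right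
      matrix_vector_mult_scaleR)

lemma psd_matrix_symmetric:
  fixes A :: "real^'n^'n"
  assumes "psd_matrix A"
  shows "(A *v x) \<bullet> y = (A *v y) \<bullet> x"
proof -
  have "(A *v x) \<bullet> y = x \<bullet> (transpose A *v y)"
    unfolding transpose_matrix_vector inner_commute[of x] dot_lmul_matrix by (rule inner_commute)
  then show ?thesis using assms unfolding psd_matrix_def by (metis inner_commute)
qed

lemma psd_matrix_cauchy_schwarz:
  fixes A :: "real^'n^'n"
  assumes "psd_matrix A"
  shows "((A *v x) \<bullet> y)\<^sup>2 \<le> ((A *v x) \<bullet> x) * ((A *v y) \<bullet> y)"
  using psd_bilinear_cauchy_schwarz[OF bilinear_matrix_form psd_matrix_symmetric[OF assms]] assms
  by (simp add: psd_matrix_def)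

lemma psd_matrix_kernel:
  fixes A :: "real^'n^'n"
  assumes "psd_matrix A" and "(A *v x) \<bullet> x = 0"
  shows "A *v x = 0"
  using psd_matrix_cauchy_schwarz[OF assms(1), of x "A *v x"] assms(2) by simp

lemma psd_invertible_posdef:
  fixes A :: "real^'n^'n"
  assumes "psd_matrix A" and "invertible A" and "x \<noteq> 0"
  shows "0 < (A *v x) \<bullet> x"
proof -
  have "A *v x \<noteq> 0"
    using assms(2,3) by (metis invertible_def matrix_vector_mul_assoc matrix_vector_mul_lid matrix_vector_mult_0_right)
  then have "(A *v x) \<bullet> x \<noteq> 0" using psd_matrix_kernel[OF assms(1)] by blast
  then show ?thesis using assms(1) by (simp add: psd_matrix_def less_le)
qed

text \<open>
  With \<open>D = B - C\<close> the hypothesis says \<open>B D = - D C\<close>, so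
  \<open>tr (D B D) = tr (B D D) = - tr (D C D)\<close>. Both \<open>D B D\<close> and \<open>D C D\<close> are positive semidefinite, so
  both traces vanish, which forces \<open>B D = C D = 0\<close> and hence \<open>D\<^sup>2 = (B - C) D = 0\<close>.
\<close>
lemma psd_sqrt_unique:
  fixes B C :: "real^'n^'n"
  assumes B: "psd_matrix B" and C: "psd_matrix C" and eq: "B ** B = C ** C"
  shows "B = C"
proof -
  define D where "D = B - C"
  have symD: "(D *v x) \<bullet> y = (D *v y) \<bullet> x" for x y
    using psd_matrix_symmetric[OF B, of x y] psd_matrix_symmetric[OF C, of x y]
    by (simp add: D_def matrix_vector_mult_diff_rdistrib inner_diff_left)
  have BB: "B *v (B *v x) = C *v (C *v x)" for x
    using eq by (simp add: matrix_vector_mul_assoc)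
  have anti: "B *v (D *v x) = - (D *v (C *v x))" for x
    by (simp add: D_def matrix_vector_mult_diff_rdistrib matrix_vector_mult_diff_distrib BB)
  let ?p = "\<lambda>i::'n. (B *v (D *v axis i 1)) \<bullet> (D *v axis i 1)"
  let ?q = "\<lambda>i::'n. (C *v (D *v axis i 1)) \<bullet> (D *v axis i 1)"
  have entry: "(E *v axis j 1) $ i = E $ i $ j" for E :: "real^'n^'n" and i j
    by (simp add: matrix_vector_mult_basis column_def)
  have trace_form: "(\<Sum>i\<in>UNIV. (D *v (E *v (D *v axis i 1))) $ i) =
      (\<Sum>i\<in>UNIV. (E *v (D *v axis i 1)) \<bullet> (D *v axis i 1))" for E :: "real^'n^'n"
  proof (rule sum.cong[OF refl])
    fix i
    have "(D *v (E *v (D *v axis i 1))) $ i = (D *v (E *v (D *v axis i 1))) \<bullet> axis i 1"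
      by (simp add: inner_axis)
    then show "(D *v (E *v (D *v axis i 1))) $ i = (E *v (D *v axis i 1)) \<bullet> (D *v axis i 1)"
      by (metis symD inner_commute)
  qed
  have "(\<Sum>i\<in>UNIV. ?p i) = (\<Sum>i\<in>UNIV. (D *v (B *v (D *v axis i 1))) $ i)"
    by (rule trace_form[symmetric])
  also have "\<dots> = trace (D ** (B ** D))"
    by (simp add: trace_def matrix_vector_mul_assoc entry matrix_mul_assoc)
  also have "\<dots> = trace ((B ** D) ** D)"
    by (rule trace_mul_sym)
  also have "\<dots> = (\<Sum>i\<in>UNIV. (B *v (D *v (D *v axis i 1))) $ i)"
    by (simp add: trace_def matrix_vector_mul_assoc entry matrix_mul_assoc)
  also have "\<dots> = - (\<Sum>i\<in>UNIV. (D *v (C *v (D *v axis i 1))) $ i)"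
    by (simp add: anti sum_negf)
  also have "\<dots> = - (\<Sum>i\<in>UNIV. ?q i)"
    by (simp only: trace_form)
  finally have "(\<Sum>i\<in>UNIV. ?p i + ?q i) = 0"
    by (simp add: sum.distrib)
  moreover have nonneg: "0 \<le> ?p i" "0 \<le> ?q i" for i
    using B C by (auto simp: psd_matrix_def)
  ultimately have "?p i + ?q i = 0" for i
    by (subst (asm) sum_nonneg_eq_0_iff) (auto intro: add_nonneg_nonneg)
  then have "?p i = 0" "?q i = 0" for i
    using nonneg[of i] by (smt (verit))+
  then have "B *v (D *v axis i 1) = 0" "C *v (D *v axis i 1) = 0" for i
    using psd_matrix_kernel[OF B] psd_matrix_kernel[OF C] by blast+
  then have "D *v (D *v axis i 1) = 0" for i
    by (simp add: D_def matrix_vector_mult_diff_rdistrib)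
  then have "D *v axis i 1 = 0" for i
    using symD[of "axis i 1" "D *v axis i 1"] by (metis inner_eq_zero_iff inner_zero_left)
  then have "D $ j $ i = 0" for i j
    using entry[of D i j] by simp
  then have "D = 0" by (simp add: vec_eq_iff)
  then show ?thesis by (simp add: D_def)
qed

text \<open>
  For small \<open>t > 0\<close> the operator \<open>X = I - t A\<close> has norm \<open>r < 1\<close>, and \<open>(I - Y)\<^sup>2 = t A\<close> amounts to
  \<open>Y = (X + Y\<^sup>2) / 2\<close>. The right-hand side is a contraction of the symmetric operators of norm at
  most \<open>r\<close>, and \<open>I - Y\<close> is positive because \<open>\<parallel>Y\<parallel> < 1\<close>.
\<close>
lemma posdef_sqrt_exists:
  fixes A :: "real^'n^'n"
  assumes psd: "psd_matrix A" and inv: "invertible A"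
  shows "\<exists>B. psd_matrix B \<and> B ** B = A"
proof -
  obtain c where c: "0 < c" "\<And>y. c * (norm y)\<^sup>2 \<le> (A *v y) \<bullet> y"
    using posdef_bilinear_coercive[OF bilinear_matrix_form[of A]] psd_invertible_posdef[OF psd inv]
    by blast
  obtain K where K: "0 < K" "\<And>y. norm (A *v y) \<le> norm y * K"
    using bounded_linear.pos_bounded[OF matrix_vector_mul_bounded_linear[of A]] by blast
  \<comment> \<open>This \<open>t\<close> minimises the bound \<open>1 - 2 t c + t\<^sup>2 K\<^sup>2\<close> for \<open>\<parallel>I - t A\<parallel>\<^sup>2\<close>.\<close>
  define t where "t = c / K\<^sup>2"
  have t: "0 < t" using c K by (simp add: t_def)
  define r where "r = sqrt (max 0 (1 - c\<^sup>2 / K\<^sup>2))"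
  have r0: "0 \<le> r" and r1: "r < 1"
    using c K by (auto simp: r_def max_def)
  define X where "X = Blinfun (\<lambda>y. y - t *\<^sub>R (A *v y))"
  have X: "blinfun_apply X y = y - t *\<^sub>R (A *v y)" for y
    unfolding X_def
    by (subst bounded_linear_Blinfun_apply)
      (auto intro!: bounded_linear_sub bounded_linear_ident bounded_linear_scaleR_right
        bounded_linear_compose[OF bounded_linear_scaleR_right matrix_vector_mul_bounded_linear])
  have "norm X \<le> r"
  proof (rule norm_blinfun_bound[OF r0])
    fix y
    have "(norm (X y))\<^sup>2 = (norm y)\<^sup>2 - 2 * t * ((A *v y) \<bullet> y) + t\<^sup>2 * (norm (A *v y))\<^sup>2"
      unfolding X power2_norm_eq_inner
      by (simp add: inner_diff_left inner_diff_right inner_commute power2_eq_square algebra_simps)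
    also have "\<dots> \<le> (norm y)\<^sup>2 - 2 * t * (c * (norm y)\<^sup>2) + t\<^sup>2 * (norm y * K)\<^sup>2"
      using c(2)[of y] K(2)[of y] t by (intro add_mono diff_mono mult_left_mono power_mono) auto
    also have "\<dots> = (1 - c\<^sup>2 / K\<^sup>2) * (norm y)\<^sup>2"
      using K(1) by (simp add: t_def field_simps power2_eq_square)
    also have "\<dots> \<le> (r * norm y)\<^sup>2"
      by (simp add: r_def power_mult_distrib mult_right_mono)
    finally show "norm (X y) \<le> r * norm y"
      by (rule power2_le_imp_le) (simp add: r0)
  qed
  define S where "S = {Y :: (real^'n) \<Rightarrow>\<^sub>L (real^'n). norm Y \<le> r \<and> (\<forall>x y. blinfun_apply Y x \<bullet> y = x \<bullet> blinfun_apply Y y)}"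
  define T where "T Y = (1/2) *\<^sub>R (X + (Y o\<^sub>L Y))" for Y
  have "closed S"
    unfolding S_def
    by (intro closed_Collect_conj closed_Collect_all closed_Collect_le closed_Collect_eq
        continuous_intros)
  then have "complete S" by (simp add: complete_eq_closed)
  have Xs: "X x \<bullet> y = x \<bullet> X y" for x y
    using psd_matrix_symmetric[OF psd, of x y]
    by (simp add: X inner_diff_left inner_diff_right inner_commute)
  have "\<exists>!Y. Y \<in> S \<and> T Y = Y"
  proof (rule Banach_fix[where c = r])
    show "complete S" "0 \<le> r" "r < 1" by fact+
    show "S \<noteq> {}" using r0 by (auto simp: S_def intro!: exI[of _ 0])
    show "T ` S \<subseteq> S"
    proof (intro subsetI; elim imageE)
      fix Z Y assume Z: "Z = T Y" and Y: "Y \<in> S"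
      have "norm (Y o\<^sub>L Y) \<le> norm Y * norm Y" by (rule norm_blinfun_compose)
      also have "\<dots> \<le> r * 1" using Y r0 r1 by (intro mult_mono) (auto simp: S_def)
      finally have "norm (X + (Y o\<^sub>L Y)) \<le> 2 * r"
        using \<open>norm X \<le> r\<close> norm_triangle_ineq[of X "Y o\<^sub>L Y"] by linarith
      then have "norm (T Y) \<le> r" by (simp add: T_def)
      moreover have "T Y x \<bullet> y = x \<bullet> T Y y" for x y
        using Xs[of x y] Y
        by (simp add: T_def S_def blinfun.bilinear_simps inner_add_left inner_add_right)
      ultimately show "Z \<in> S" by (simp add: S_def Z)
    qed
    fix Y Z assume "Y \<in> S" "Z \<in> S"
    then have YZ: "norm Y \<le> r" "norm Z \<le> r" by (auto simp: S_def)
    have "T Y - T Z = (1/2) *\<^sub>R ((Y o\<^sub>L (Y - Z)) + ((Y - Z) o\<^sub>L Z))"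
      by (rule blinfun_eqI) (simp add: T_def blinfun.bilinear_simps algebra_simps)
    then have "dist (T Y) (T Z) \<le> (1/2) * (norm (Y o\<^sub>L (Y - Z)) + norm ((Y - Z) o\<^sub>L Z))"
      by (simp add: dist_norm norm_triangle_ineq)
    also have "\<dots> \<le> (1/2) * (norm Y * norm (Y - Z) + norm (Y - Z) * norm Z)"
      by (intro mult_left_mono add_mono norm_blinfun_compose) simp
    also have "\<dots> \<le> (1/2) * (r * norm (Y - Z) + norm (Y - Z) * r)"
      using YZ by (intro mult_left_mono add_mono mult_right_mono) auto
    finally show "dist (T Y) (T Z) \<le> r * dist Y Z" by (simp add: dist_norm)
  qed
  then obtain Y where Y: "Y \<in> S" "T Y = Y" by blast
  have fix_eq: "2 *\<^sub>R Y y = X y + Y (Y y)" for y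
  proof -
    have "2 *\<^sub>R Y y = 2 *\<^sub>R (T Y) y" using Y(2) by simp
    then show ?thesis by (simp add: T_def blinfun.bilinear_simps scaleR_add_right)
  qed
  define B where "B = matrix (\<lambda>y. (1 / sqrt t) *\<^sub>R (y - Y y))"
  have B: "B *v y = (1 / sqrt t) *\<^sub>R (y - Y y)" for y
  proof -
    have "linear (\<lambda>y. (1 / sqrt t) *\<^sub>R (y - Y y))"
      by (intro linearI) (auto simp: blinfun.bilinear_simps algebra_simps)
    then show ?thesis unfolding B_def by (simp add: matrix_vector_mul)
  qed
  have "B *v (B *v y) = A *v y" for y
  proof -
    have "B *v (B *v y) = (1 / t) *\<^sub>R (y - 2 *\<^sub>R Y y + Y (Y y))"
      using t by (simp add: B blinfun.bilinear_simps algebra_simps scaleR_2)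
    also have "\<dots> = A *v y" unfolding fix_eq using t by (simp add: X)
    finally show ?thesis .
  qed
  then have "B ** B = A" by (simp add: matrix_eq flip: matrix_vector_mul_assoc)
  moreover have "psd_matrix B"
    unfolding psd_matrix_def
  proof (intro conjI allI)
    have "(B *v x) \<bullet> y = x \<bullet> (B *v y)" for x y
      using Y(1) by (simp add: B S_def inner_diff_left inner_diff_right)
    then have "(transpose B *v y) \<bullet> x = (B *v y) \<bullet> x" for x y
      by (metis dot_lmul_matrix inner_commute transpose_matrix_vector transpose_transpose)
    then have "transpose B *v y = B *v y" for y
      by (metis vector_eq_rdot)
    then show "transpose B = B" by (simp add: matrix_eq)
    fix y
    have "Y y \<bullet> y \<le> norm (Y y) * norm y" by (rule norm_cauchy_schwarz)
    also have "\<dots> \<le> (1 * norm y) * norm y"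
      using Y(1) r1
      by (intro mult_right_mono order_trans[OF norm_blinfun]) (auto simp: S_def)
    finally show "0 \<le> (B *v y) \<bullet> y"
      using t by (simp add: B inner_diff_left dot_square_norm power2_eq_square)
  qed
  ultimately show ?thesis by blast
qed

lemma norm_matrix_sqrt_mult:
  fixes A :: "real^'n^'n"
  assumes "psd_matrix A" and "invertible A"
  shows "(norm (matrix_sqrt A *v x))\<^sup>2 = (A *v x) \<bullet> x"
proof -
  have ex1: "\<exists>!B. psd_matrix B \<and> B ** B = A"
    using posdef_sqrt_exists[OF assms] psd_sqrt_unique by blast
  then have B: "psd_matrix (matrix_sqrt A)" "matrix_sqrt A ** matrix_sqrt A = A"
    using theI'[OF ex1] unfolding matrix_sqrt_def by blast+
  have "(norm (matrix_sqrt A *v x))\<^sup>2 = (matrix_sqrt A *v (matrix_sqrt A *v x)) \<bullet> x"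
    using psd_matrix_symmetric[OF B(1)] by (simp add: power2_norm_eq_inner)
  then show ?thesis by (simp add: matrix_vector_mul_assoc B(2))
qed

section \<open>Square-integrable functions for a measurable family of forms\<close>

text \<open>
  Functions are not identified modulo null sets, and \<open>B\<close> may be degenerate, so \<open>form_inner\<close> is in general
  only a positive semidefinite form on \<open>form_L2\<close>.
\<close>
definition form_L2 :: "'a measure \<Rightarrow> ('a \<Rightarrow> 'b \<Rightarrow> 'b \<Rightarrow> real) \<Rightarrow> ('a \<Rightarrow> 'b::euclidean_space) set" where
  "form_L2 M B = {w \<in> borel_measurable M. integrable M (\<lambda>x. B x (w x) (w x))}"

definition form_inner ::
    "'a measure \<Rightarrow> ('a \<Rightarrow> 'b \<Rightarrow> 'b \<Rightarrow> real) \<Rightarrow> ('a \<Rightarrow> 'b::euclidean_space) \<Rightarrow> ('a \<Rightarrow> 'b) \<Rightarrow> real" where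
  "form_inner M B w z = (LINT x|M. B x (w x) (z x))"

definition form_dist2 ::
    "'a measure \<Rightarrow> ('a \<Rightarrow> 'b \<Rightarrow> 'b \<Rightarrow> real) \<Rightarrow> ('a \<Rightarrow> 'b::euclidean_space) \<Rightarrow> ('a \<Rightarrow> 'b) \<Rightarrow> real" where
  "form_dist2 M B w z = form_inner M B (\<lambda>x. w x - z x) (\<lambda>x. w x - z x)"

locale measurable_psd_form =
  fixes M :: "'a measure" and B :: "'a \<Rightarrow> 'b::euclidean_space \<Rightarrow> 'b \<Rightarrow> real"
  assumes bilinear: "x \<in> space M \<Longrightarrow> bilinear (B x)"
    and sym: "x \<in> space M \<Longrightarrow> B x y z = B x z y"
    and nonneg: "x \<in> space M \<Longrightarrow> 0 \<le> B x y y"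
    and measurable_Basis: "i \<in> Basis \<Longrightarrow> j \<in> Basis \<Longrightarrow> (\<lambda>x. B x i j) \<in> borel_measurable M"
begin

lemma measurable_form:
  assumes [measurable]: "w \<in> borel_measurable M" "z \<in> borel_measurable M"
  shows "(\<lambda>x. B x (w x) (z x)) \<in> borel_measurable M"
proof -
  have *: "B x (w x) (z x) = (\<Sum>i\<in>Basis. \<Sum>j\<in>Basis. (w x \<bullet> i) * (z x \<bullet> j) * B x i j)"
    if "x \<in> space M" for x
  proof -
    note b = bilinear[OF that]
    have "B x (w x) (z x) = B x (\<Sum>i\<in>Basis. (w x \<bullet> i) *\<^sub>R i) (\<Sum>j\<in>Basis. (z x \<bullet> j) *\<^sub>R j)"
      by (simp add: euclidean_representation)
    also have "\<dots> = (\<Sum>(i,j)\<in>Basis \<times> Basis. B x ((w x \<bullet> i) *\<^sub>R i) ((z x \<bullet> j) *\<^sub>R j))"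
      by (rule bilinear_sum[OF b])
    finally show ?thesis
      by (simp add: sum.cartesian_product bilinear_lmul[OF b] bilinear_rmul[OF b] ac_simps)
  qed
  have "(\<lambda>x. \<Sum>i\<in>Basis. \<Sum>j\<in>Basis. (w x \<bullet> i) * (z x \<bullet> j) * B x i j) \<in> borel_measurable M"
    using measurable_Basis by (intro borel_measurable_sum borel_measurable_times) auto
  then show ?thesis by (subst measurable_cong[OF *])
qed

lemma abs_form_le: "x \<in> space M \<Longrightarrow> 2 * \<bar>B x y z\<bar> \<le> B x y y + B x z z"
  using nonneg[of x "y + z"] nonneg[of x "y - z"] bilinear[of x] sym[of x z y]
  by (simp add: bilinear_ladd bilinear_radd bilinear_lsub bilinear_rsub)

lemma form_L2_measurable: "w \<in> form_L2 M B \<Longrightarrow> w \<in> borel_measurable M"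
  by (simp add: form_L2_def)

lemma integrable_form:
  assumes "w \<in> form_L2 M B" "z \<in> form_L2 M B"
  shows "integrable M (\<lambda>x. B x (w x) (z x))"
proof (rule Bochner_Integration.integrable_bound)
  show "integrable M (\<lambda>x. B x (w x) (w x) + B x (z x) (z x))"
    using assms by (auto simp: form_L2_def)
  show "(\<lambda>x. B x (w x) (z x)) \<in> borel_measurable M"
    using assms by (intro measurable_form) (auto simp: form_L2_def)
  show "AE x in M. norm (B x (w x) (z x)) \<le> norm (B x (w x) (w x) + B x (z x) (z x))"
  proof (rule AE_I2)
    fix x assume "x \<in> space M"
    then show "norm (B x (w x) (z x)) \<le> norm (B x (w x) (w x) + B x (z x) (z x))"
      using abs_form_le[of x "w x" "z x"] nonneg[of x] by simp
  qed
qed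

lemma form_comb_self:
  "x \<in> space M \<Longrightarrow> B x (y + c *\<^sub>R z) (y + c *\<^sub>R z) = B x y y + 2 * c * B x y z + c\<^sup>2 * B x z z"
  using bilinear[of x] sym[of x z y]
  by (simp add: bilinear_ladd bilinear_radd bilinear_lmul bilinear_rmul power2_eq_square
      algebra_simps)

lemma form_L2_comb:
  assumes "w \<in> form_L2 M B" "z \<in> form_L2 M B"
  shows "(\<lambda>x. w x + c *\<^sub>R z x) \<in> form_L2 M B"
proof -
  have "integrable M (\<lambda>x. B x (w x) (w x) + 2 * c * B x (w x) (z x) + c\<^sup>2 * B x (z x) (z x))"
    using assms integrable_form by auto
  then have "integrable M (\<lambda>x. B x (w x + c *\<^sub>R z x) (w x + c *\<^sub>R z x))"
    by (subst Bochner_Integration.integrable_cong[OF refl form_comb_self])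
  then show ?thesis
    using assms by (auto simp: form_L2_def)
qed

lemma form_L2_diff:
  assumes "w \<in> form_L2 M B" "z \<in> form_L2 M B"
  shows "(\<lambda>x. w x - z x) \<in> form_L2 M B"
  using form_L2_comb[OF assms, of "-1"] by simp

lemma form_inner_comb:
  assumes "w \<in> form_L2 M B" "z \<in> form_L2 M B" "y \<in> form_L2 M B"
  shows "form_inner M B (\<lambda>x. w x + c *\<^sub>R z x) y = form_inner M B w y + c * form_inner M B z y"
proof -
  have "form_inner M B (\<lambda>x. w x + c *\<^sub>R z x) y = (LINT x|M. B x (w x) (y x) + c * B x (z x) (y x))"
    unfolding form_inner_def
    using bilinear by (intro Bochner_Integration.integral_cong refl) (simp add: bilinear_ladd bilinear_lmul)
  then show ?thesis
    using integrable_form assms by (simp add: form_inner_def)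
qed

lemma form_inner_diff:
  assumes "w \<in> form_L2 M B" "z \<in> form_L2 M B" "y \<in> form_L2 M B"
  shows "form_inner M B (\<lambda>x. w x - z x) y = form_inner M B w y - form_inner M B z y"
  using form_inner_comb[OF assms, of "-1"] by simp

lemma form_inner_sym: "form_inner M B w z = form_inner M B z w"
  unfolding form_inner_def using sym by (intro Bochner_Integration.integral_cong refl)

lemma form_inner_nonneg: "0 \<le> form_inner M B w w"
  unfolding form_inner_def using nonneg by (intro integral_nonneg_AE AE_I2)

lemma form_dist2_nonneg: "0 \<le> form_dist2 M B w z"
  unfolding form_dist2_def by (rule form_inner_nonneg)

lemma form_inner_comb_self:
  assumes "w \<in> form_L2 M B" "z \<in> form_L2 M B"
  shows "form_inner M B (\<lambda>x. w x + c *\<^sub>R z x) (\<lambda>x. w x + c *\<^sub>R z x)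
    = form_inner M B w w + 2 * c * form_inner M B w z + c\<^sup>2 * form_inner M B z z"
proof -
  have "form_inner M B (\<lambda>x. w x + c *\<^sub>R z x) (\<lambda>x. w x + c *\<^sub>R z x) =
      (LINT x|M. B x (w x) (w x) + 2 * c * B x (w x) (z x) + c\<^sup>2 * B x (z x) (z x))"
    unfolding form_inner_def by (intro Bochner_Integration.integral_cong refl form_comb_self)
  then show ?thesis
    using integrable_form assms by (simp add: form_inner_def)
qed

lemma form_inner_cauchy_schwarz:
  assumes "w \<in> form_L2 M B" "z \<in> form_L2 M B"
  shows "(form_inner M B w z)\<^sup>2 \<le> form_inner M B w w * form_inner M B z z"
proof (rule discriminant_bound)
  show "0 \<le> form_inner M B w w + 2 * t * form_inner M B w z + t\<^sup>2 * form_inner M B z z" for t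
    using form_inner_nonneg form_inner_comb_self[OF assms, of t] by metis
qed (rule form_inner_nonneg)

lemma form_inner_add_le:
  assumes "w \<in> form_L2 M B" "z \<in> form_L2 M B"
  shows "form_inner M B (\<lambda>x. w x + z x) (\<lambda>x. w x + z x)
    \<le> 2 * form_inner M B w w + 2 * form_inner M B z z"
  using form_inner_comb_self[OF assms, of 1] form_inner_comb_self[OF assms, of "-1"]
    form_inner_nonneg[of "\<lambda>x. w x - z x"]
  by simp

lemma abs_form_inner_le:
  assumes "w \<in> form_L2 M B" "z \<in> form_L2 M B"
  shows "2 * \<bar>form_inner M B w z\<bar> \<le> form_inner M B w w + form_inner M B z z"
  using form_inner_comb_self[OF assms, of 1] form_inner_comb_self[OF assms, of "-1"]
    form_inner_nonneg[of "\<lambda>x. w x - z x"] form_inner_nonneg[of "\<lambda>x. w x + z x"]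
  by simp

lemma form_inner_tendsto:
  assumes U: "U \<in> form_L2 M B" and w: "\<And>k. w k \<in> form_L2 M B" and z: "z \<in> form_L2 M B"
    and lim: "(\<lambda>k. form_dist2 M B U (w k)) \<longlonglongrightarrow> 0"
  shows "(\<lambda>k. form_inner M B (w k) z) \<longlonglongrightarrow> form_inner M B U z"
proof (rule Lim_null[THEN iffD2], rule Lim_null_comparison)
  show "(\<lambda>k. sqrt (form_dist2 M B U (w k) * form_inner M B z z)) \<longlonglongrightarrow> 0"
    using tendsto_real_sqrt[OF tendsto_mult_left_zero[OF lim]] by simp
  have "norm (form_inner M B (w k) z - form_inner M B U z)
      \<le> sqrt (form_dist2 M B U (w k) * form_inner M B z z)" for k
  proof -
    have "norm (form_inner M B (w k) z - form_inner M B U z) =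
        sqrt ((form_inner M B (\<lambda>x. U x - w k x) z)\<^sup>2)"
      by (simp add: form_inner_diff[OF U w z])
    then show ?thesis
      using real_sqrt_le_mono[OF form_inner_cauchy_schwarz[OF form_L2_diff[OF U w[of k]] z]]
      by (simp add: form_dist2_def)
  qed
  then show "\<forall>\<^sub>F k in sequentially. norm (form_inner M B (w k) z - form_inner M B U z)
      \<le> sqrt (form_dist2 M B U (w k) * form_inner M B z z)"
    by (rule always_eventually[OF allI])
qed

text \<open>
  For \<open>J w = a(w, w) - 2 F w\<close> with infimum \<open>I\<close> and \<open>d\<^sub>k = J w\<^sub>k - I\<close>, the inequality
  \<open>I \<le> J (w\<^sub>k + t z)\<close> for all \<open>t\<close> is a quadratic inequality in \<open>t\<close>, whose discriminant gives
  \<open>(a(w\<^sub>k, z) - F z)\<^sup>2 \<le> d\<^sub>k a(z, z)\<close>. This yields the convergence to \<open>F z\<close>; choosing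
  \<open>z = w\<^sub>k - w\<^sub>l\<close> and subtracting gives \<open>\<parallel>w\<^sub>k - w\<^sub>l\<parallel> \<le> \<surd>d\<^sub>k + \<surd>d\<^sub>l\<close>.
\<close>
lemma minimising_sequence:
  assumes sub: "V \<subseteq> form_L2 M B" and ne: "V \<noteq> {}"
    and comb: "\<And>w z c. w \<in> V \<Longrightarrow> z \<in> V \<Longrightarrow> (\<lambda>x. w x + c *\<^sub>R z x) \<in> V"
    and lin: "\<And>w z c. w \<in> V \<Longrightarrow> z \<in> V \<Longrightarrow> F (\<lambda>x. w x + c *\<^sub>R z x) = F w + c * F z"
    and below: "\<And>w. w \<in> V \<Longrightarrow> m \<le> form_inner M B w w - 2 * F w"
  obtains w where "\<And>k. w k \<in> V"
    and "\<And>z. z \<in> V \<Longrightarrow> (\<lambda>k. form_inner M B (w k) z) \<longlonglongrightarrow> F z"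
    and "\<And>\<epsilon>. 0 < \<epsilon> \<Longrightarrow> \<exists>N. \<forall>k\<ge>N. \<forall>l\<ge>N. form_dist2 M B (w k) (w l) < \<epsilon>"
proof -
  let ?a = "form_inner M B"
  define J where "J w = ?a w w - 2 * F w" for w
  define I where "I = Inf (J ` V)"
  have bdd: "bdd_below (J ` V)" using below by (auto simp: J_def intro!: bdd_belowI2)
  have I_le: "I \<le> J w" if "w \<in> V" for w
    unfolding I_def using that bdd by (intro cInf_lower) auto
  have "\<exists>w\<in>V. J w < I + 1 / (real k + 1)" for k :: nat
    using cInf_lessD[of "J ` V" "I + 1 / (real k + 1)"] ne by (auto simp: I_def)
  then obtain w where w: "\<And>k. w k \<in> V" "\<And>k. J (w k) < I + 1 / (real k + 1)"
    by metis
  define d where "d k = J (w k) - I" for k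
  have d0: "0 \<le> d k" for k using I_le[OF w(1)] by (simp add: d_def)
  have d_lim: "d \<longlonglongrightarrow> 0"
  proof (rule tendsto_sandwich[OF _ _ tendsto_const])
    show "(\<lambda>k. 1 / (real k + 1)) \<longlonglongrightarrow> 0" 
      using LIMSEQ_inverse_real_of_nat by (simp add: field_simps)
    show "\<forall>\<^sub>F k in sequentially. d k \<le> 1 / (real k + 1)"
      using w(2) by (auto simp: d_def less_imp_le algebra_simps intro!: always_eventually)
  qed (use d0 in simp)
  have key: "(?a (w k) z - F z)\<^sup>2 \<le> d k * ?a z z" if z: "z \<in> V" for k z
  proof (rule discriminant_bound)
    fix t
    have "I \<le> J (\<lambda>x. w k x + t *\<^sub>R z x)" by (rule I_le[OF comb[OF w(1) z]])
    also have "\<dots> = J (w k) + 2 * t * (?a (w k) z - F z) + t\<^sup>2 * ?a z z"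
      using sub w(1)[of k] z
      by (subst J_def, subst form_inner_comb_self) (auto simp: lin J_def algebra_simps)
    finally show "0 \<le> d k + 2 * t * (?a (w k) z - F z) + t\<^sup>2 * ?a z z"
      by (simp add: d_def)
  qed (rule form_inner_nonneg)
  have key': "\<bar>?a (w k) z - F z\<bar> \<le> sqrt (d k) * sqrt (?a z z)" if "z \<in> V" for k z
    using real_sqrt_le_mono[OF key[OF that, of k]] by (simp add: real_sqrt_mult)
  show thesis
  proof (rule that)
    show "w k \<in> V" for k by (rule w)
    fix z assume z: "z \<in> V"
    show "(\<lambda>k. ?a (w k) z) \<longlonglongrightarrow> F z"
    proof (rule Lim_null[THEN iffD2], rule Lim_null_comparison)
      show "(\<lambda>k. sqrt (d k) * sqrt (?a z z)) \<longlonglongrightarrow> 0"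
        using tendsto_real_sqrt[OF d_lim] by (intro tendsto_mult_left_zero) simp
    qed (use key'[OF z] in simp)
  next
    fix \<epsilon> :: real assume "0 < \<epsilon>"
    have "(\<lambda>k. sqrt (d k)) \<longlonglongrightarrow> 0" using tendsto_real_sqrt[OF d_lim] by simp
    then obtain N where N: "\<And>k. k \<ge> N \<Longrightarrow> sqrt (d k) < sqrt \<epsilon> / 2"
      using order_tendstoD(2)[of "\<lambda>k. sqrt (d k)" 0 sequentially "sqrt \<epsilon> / 2"] \<open>0 < \<epsilon>\<close>
      by (auto simp: eventually_sequentially)
    have "form_dist2 M B (w k) (w l) < \<epsilon>" if "k \<ge> N" "l \<ge> N" for k l
    proof -
      define D where "D = (\<lambda>x. w k x - w l x)"
      have D: "D \<in> V" using comb[OF w(1)[of k] w(1)[of l], of "-1"] by (simp add: D_def)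
      define s where "s = sqrt (?a D D)"
      have s: "0 \<le> s" "s * s = ?a D D" using form_inner_nonneg by (auto simp: s_def)
      have "?a D D = ?a (w k) D - ?a (w l) D"
        using sub D w(1) by (subst (1) D_def, intro form_inner_diff) auto
      then have "s * s \<le> (sqrt (d k) + sqrt (d l)) * s"
        using key'[OF D, of k] key'[OF D, of l] s(2) by (simp add: s_def distrib_right)
      then have "s \<le> sqrt (d k) + sqrt (d l)"
        using s(1) d0 by (cases "s = 0") auto
      also have "\<dots> < sqrt \<epsilon>" using N[OF that(1)] N[OF that(2)] by simp
      finally have "?a D D < \<epsilon>" by (simp add: s_def)
      then show ?thesis by (simp add: form_dist2_def D_def)
    qed
    then show "\<exists>N. \<forall>k\<ge>N. \<forall>l\<ge>N. form_dist2 M B (w k) (w l) < \<epsilon>" by blast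
  qed
qed

lemma nn_integral_form:
  assumes "w \<in> form_L2 M B"
  shows "(\<integral>\<^sup>+ x. ennreal (B x (w x) (w x)) \<partial>M) = ennreal (form_inner M B w w)"
  unfolding form_inner_def
  using integrable_form[OF assms assms] nonneg by (intro nn_integral_eq_integral AE_I2) auto

lemma nn_integral_form_dist2:
  assumes "w \<in> form_L2 M B" "z \<in> form_L2 M B"
  shows "(\<integral>\<^sup>+ x. ennreal (B x (w x - z x) (w x - z x)) \<partial>M) = ennreal (form_dist2 M B w z)"
  unfolding form_dist2_def by (rule nn_integral_form[OF form_L2_diff[OF assms]])

lemma form_L2_iff:
  assumes w: "w \<in> borel_measurable M"
  shows "w \<in> form_L2 M B \<longleftrightarrow> (\<integral>\<^sup>+ x. ennreal (B x (w x) (w x)) \<partial>M) < \<infinity>"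
proof -
  have "integrable M (\<lambda>x. B x (w x) (w x))" if "(\<integral>\<^sup>+ x. ennreal (B x (w x) (w x)) \<partial>M) < \<infinity>"
    using nonneg that by (intro integrableI_nonneg measurable_form w AE_I2)
  then show ?thesis
    using w nn_integral_form[of w] by (auto simp: form_L2_def)
qed

text \<open>
  The integral of \<open>\<Sum>k. 2\<^sup>k B(w\<^sub>k\<^sub>+\<^sub>1 - w\<^sub>k, w\<^sub>k\<^sub>+\<^sub>1 - w\<^sub>k)\<close> is at most \<open>\<Sum>k. 2\<^sup>-\<^sup>k\<close>, so the sum is
  finite at almost every \<open>x\<close>. Positive definiteness at \<open>x\<close> turns this into a geometric bound for
  \<open>|w\<^sub>k\<^sub>+\<^sub>1(x) - w\<^sub>k(x)|\<close>, with a constant that depends on \<open>x\<close>.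
\<close>
lemma fast_cauchy_AE_convergent:
  assumes w: "\<And>k. w k \<in> form_L2 M B"
    and pos: "AE x in M. \<forall>y. y \<noteq> 0 \<longrightarrow> 0 < B x y y"
    and fast: "\<And>k. form_dist2 M B (w (Suc k)) (w k) \<le> (1/4) ^ k"
  shows "AE x in M. convergent (\<lambda>k. w k x)"
proof -
  have fin: "AE x in M. (\<Sum>k. ennreal (2 ^ k * B x (w (Suc k) x - w k x) (w (Suc k) x - w k x))) \<noteq> \<infinity>"
  proof -
    let ?g = "\<lambda>k x. B x (w (Suc k) x - w k x) (w (Suc k) x - w k x)"
    let ?f = "\<lambda>k x. ennreal (2 ^ k * ?g k x)"
    have [measurable]: "w k \<in> borel_measurable M" for k using w form_L2_measurable by blast
    have [measurable]: "?g k \<in> borel_measurable M" for k by (rule measurable_form) measurable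
    have "(\<integral>\<^sup>+ x. ?f k x \<partial>M) \<le> ennreal ((1/2) ^ k)" for k
    proof -
      have "(\<integral>\<^sup>+ x. ?f k x \<partial>M) = (\<integral>\<^sup>+ x. ennreal (2 ^ k) * ennreal (?g k x) \<partial>M)"
        using nonneg by (intro nn_integral_cong) (simp add: ennreal_mult)
      also have "\<dots> = ennreal (2 ^ k) * ennreal (form_dist2 M B (w (Suc k)) (w k))"
        by (subst nn_integral_cmult) (auto simp: nn_integral_form_dist2 w)
      also have "\<dots> = ennreal (2 ^ k * form_dist2 M B (w (Suc k)) (w k))"
        by (simp add: ennreal_mult form_dist2_nonneg)
      also have "\<dots> \<le> ennreal (2 ^ k * (1/4) ^ k)"
        using fast[of k] by (intro ennreal_leI mult_left_mono) auto
      also have "2 ^ k * (1/4) ^ k = ((1/2)::real) ^ k"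
        by (simp flip: power_mult_distrib)
      finally show ?thesis .
    qed
    then have "(\<integral>\<^sup>+ x. (\<Sum>k. ?f k x) \<partial>M) \<le> (\<Sum>k. ennreal ((1/2) ^ k))"
      by (subst nn_integral_suminf) (auto intro!: suminf_le)
    also have "\<dots> = ennreal (\<Sum>k. (1/2) ^ k)"
      by (intro suminf_ennreal2) auto
    finally have "(\<integral>\<^sup>+ x. (\<Sum>k. ?f k x) \<partial>M) \<noteq> \<infinity>"
      by (auto simp: top_unique)
    then show ?thesis
      by (intro nn_integral_PInf_AE) auto
  qed
  show ?thesis
    using pos fin AE_space
  proof eventually_elim
    case (elim x)
    note b = bilinear[OF elim(3)]
    obtain c where c: "0 < c" "\<And>y. c * (norm y)\<^sup>2 \<le> B x y y"
      using posdef_bilinear_coercive[OF b] elim(1) by blast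
    let ?d = "\<lambda>k. w (Suc k) x - w k x"
    define S where "S = enn2real (\<Sum>k. ennreal (2 ^ k * B x (?d k) (?d k)))"
    have S: "2 ^ k * B x (?d k) (?d k) \<le> S" for k
    proof -
      have "ennreal (2 ^ k * B x (?d k) (?d k)) \<le> (\<Sum>k. ennreal (2 ^ k * B x (?d k) (?d k)))"
        using sum_le_suminf[of "\<lambda>k. ennreal (2 ^ k * B x (?d k) (?d k))" "{k}"] by simp
      also have "\<dots> = ennreal S" using elim(2) by (simp add: S_def top.not_eq_extremum)
      finally show ?thesis
        by (subst (asm) ennreal_le_iff) (simp_all add: S_def)
    qed
    have bound: "norm (?d k) \<le> sqrt (S / c) * (sqrt (1/2)) ^ k" for k
    proof -
      have "2 ^ k * (c * (norm (?d k))\<^sup>2) \<le> S"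
        using S[of k] c(2)[of "?d k"] by (meson mult_left_mono order_trans zero_le_numeral zero_le_power)
      then have "(norm (?d k))\<^sup>2 \<le> S / c * (1/2) ^ k"
        using c(1) by (simp add: field_simps power_one_over)
      then have "sqrt ((norm (?d k))\<^sup>2) \<le> sqrt (S / c * (1/2) ^ k)"
        by (rule real_sqrt_le_mono)
      then show ?thesis by (simp only: real_sqrt_mult real_sqrt_power[of "1/2" k] real_sqrt_abs abs_norm_cancel)
    qed
    have "summable (\<lambda>k. sqrt (S / c) * (sqrt (1/2)) ^ k)"
      by (intro summable_mult summable_geometric) (simp add: real_sqrt_divide)
    then have "summable ?d"
      using bound by (rule summable_comparison_test'[where N = 0]) 
    then have "convergent (\<lambda>n. \<Sum>k<n. ?d k)"
      by (simp add: summable_iff_convergent)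
    then have "convergent (\<lambda>n. w n x - w 0 x)"
      by (simp only: sum_lessThan_telescope[of "\<lambda>n. w n x"])
    from convergent_add[OF this convergent_const[of "w 0 x"]] show ?case by simp
  qed
qed

text \<open>
  Riesz--Fischer: a rapidly converging subsequence has a pointwise limit \<open>U\<close> almost everywhere, and
  Fatou's lemma along the subsequence bounds the distance of \<open>U\<close> to each term of the full sequence.
\<close>
lemma form_L2_complete:
  assumes w: "\<And>k. w k \<in> form_L2 M B"
    and pos: "AE x in M. \<forall>y. y \<noteq> 0 \<longrightarrow> 0 < B x y y"
    and cauchy: "\<And>\<epsilon>. 0 < \<epsilon> \<Longrightarrow> \<exists>N. \<forall>k\<ge>N. \<forall>l\<ge>N. form_dist2 M B (w k) (w l) < \<epsilon>"
  obtains U where "U \<in> form_L2 M B" and "(\<lambda>k. form_dist2 M B U (w k)) \<longlonglongrightarrow> 0"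
proof -
  have "\<exists>N. \<forall>k\<ge>N. \<forall>l\<ge>N. form_dist2 M B (w k) (w l) < (1/4) ^ i" for i
    by (rule cauchy) simp
  then obtain N where N: "\<And>i k l. k \<ge> N i \<Longrightarrow> l \<ge> N i \<Longrightarrow> form_dist2 M B (w k) (w l) < (1/4) ^ i"
    by metis
  \<comment> \<open>The summand \<open>i\<close> makes \<open>r\<close> tend to infinity, which Fatou's lemma below relies on.\<close>
  define r where "r i = i + (\<Sum>j\<le>i. N j)" for i
  have r_id: "i \<le> r i" for i by (simp add: r_def)
  have r_N: "N i \<le> r i" "N i \<le> r (Suc i)" for i
    using member_le_sum[of i "{..i}" N] by (simp_all add: r_def)
  let ?W = "\<lambda>i. w (r i)"
  have conv: "AE x in M. convergent (\<lambda>i. ?W i x)"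
    using w N r_N less_imp_le by (intro fast_cauchy_AE_convergent pos) blast+
  define U where "U x = lim (\<lambda>i. ?W i x)" for x
  have [measurable]: "w k \<in> borel_measurable M" for k using w form_L2_measurable by blast
  have U_meas[measurable]: "U \<in> borel_measurable M" unfolding U_def by measurable
  have fatou: "(\<integral>\<^sup>+ x. ennreal (B x (U x - w k x) (U x - w k x)) \<partial>M) \<le> ennreal \<epsilon>"
    if k: "\<And>l. l \<ge> n \<Longrightarrow> form_dist2 M B (w l) (w k) \<le> \<epsilon>" for k n \<epsilon>
  proof -
    have "AE x in M. ennreal (B x (U x - w k x) (U x - w k x)) =
        liminf (\<lambda>i. ennreal (B x (?W i x - w k x) (?W i x - w k x)))"
      using conv AE_space
    proof eventually_elim
      case (elim x)
      have "(\<lambda>i. ?W i x) \<longlonglongrightarrow> U x"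
        unfolding U_def using elim(1) by (simp add: convergent_LIMSEQ_iff)
      then have lim: "(\<lambda>i. ?W i x - w k x) \<longlonglongrightarrow> U x - w k x"
        by (intro tendsto_diff tendsto_const)
      have "bounded_bilinear (B x)"
        using bilinear[OF elim(2)] by (simp add: bilinear_conv_bounded_bilinear)
      from tendsto_ennrealI[OF bounded_bilinear.tendsto[OF this lim lim]]
      have "(\<lambda>i. ennreal (B x (?W i x - w k x) (?W i x - w k x)))
          \<longlonglongrightarrow> ennreal (B x (U x - w k x) (U x - w k x))" .
      then show ?case by (simp add: lim_imp_Liminf)
    qed
    then have "(\<integral>\<^sup>+ x. ennreal (B x (U x - w k x) (U x - w k x)) \<partial>M) =
        (\<integral>\<^sup>+ x. liminf (\<lambda>i. ennreal (B x (?W i x - w k x) (?W i x - w k x))) \<partial>M)"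
      by (rule nn_integral_cong_AE)
    also have "\<dots> \<le> liminf (\<lambda>i. \<integral>\<^sup>+ x. ennreal (B x (?W i x - w k x) (?W i x - w k x)) \<partial>M)"
      by (intro nn_integral_liminf measurable_compose[OF _ measurable_ennreal] measurable_form)
        measurable
    also have "\<dots> = liminf (\<lambda>i. ennreal (form_dist2 M B (?W i) (w k)))"
      by (simp add: nn_integral_form_dist2 w)
    also have "\<dots> \<le> liminf (\<lambda>i. ennreal \<epsilon>)"
    proof (rule Liminf_mono)
      show "\<forall>\<^sub>F i in sequentially. ennreal (form_dist2 M B (?W i) (w k)) \<le> ennreal \<epsilon>"
        using eventually_ge_at_top[of n]
        by eventually_elim (meson ennreal_leI k order_trans r_id)
    qed
    finally show ?thesis by (simp add: Liminf_const)
  qed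
  have "\<exists>n. \<forall>k\<ge>n. \<forall>l\<ge>n. form_dist2 M B (w k) (w l) < 1" by (rule cauchy) simp
  then obtain n where n: "\<And>k l. k \<ge> n \<Longrightarrow> l \<ge> n \<Longrightarrow> form_dist2 M B (w k) (w l) < 1" by blast
  have "(\<integral>\<^sup>+ x. ennreal (B x (U x - w n x) (U x - w n x)) \<partial>M) \<le> ennreal 1"
    using n by (intro fatou[of n]) (auto intro: less_imp_le)
  then have "(\<lambda>x. U x - w n x) \<in> form_L2 M B"
    unfolding form_L2_def using nonneg
    by (auto intro!: integrableI_nonneg measurable_form AE_I2 simp: less_top[symmetric] top_unique)
  from form_L2_comb[OF this w[of n], of 1] have U: "U \<in> form_L2 M B" by simp
  have "(\<lambda>k. form_dist2 M B U (w k)) \<longlonglongrightarrow> 0"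
  proof (rule LIMSEQ_I)
    fix \<epsilon> :: real assume "0 < \<epsilon>"
    then obtain n where n: "\<And>k l. k \<ge> n \<Longrightarrow> l \<ge> n \<Longrightarrow> form_dist2 M B (w k) (w l) < \<epsilon> / 2"
      using cauchy[of "\<epsilon> / 2"] by auto
    have "norm (form_dist2 M B U (w k) - 0) < \<epsilon>" if "k \<ge> n" for k
    proof -
      have "ennreal (form_dist2 M B U (w k)) \<le> ennreal (\<epsilon> / 2)"
        unfolding nn_integral_form_dist2[OF U w, symmetric]
        using n that by (intro fatou[of n]) (auto intro: less_imp_le)
      then show ?thesis using \<open>0 < \<epsilon>\<close> form_dist2_nonneg[of U "w k"] by simp
    qed
    then show "\<exists>n. \<forall>k\<ge>n. norm (form_dist2 M B U (w k) - 0) < \<epsilon>" by blast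
  qed
  with U show thesis by (rule that)
qed

end

section \<open>Weak solutions for a pair of forms\<close>


lemma measurable_psd_form_add:
  assumes "measurable_psd_form M P" "measurable_psd_form M R"
  shows "measurable_psd_form M (\<lambda>x y z. P x y z + R x y z)"
proof -
  interpret P: measurable_psd_form M P by fact
  interpret R: measurable_psd_form M R by fact
  show ?thesis
  proof
    show "bilinear (\<lambda>y z. P x y z + R x y z)" if "x \<in> space M" for x
      using P.bilinear[OF that] R.bilinear[OF that]
      by (auto simp: bilinear_def intro!: linear_compose_add)
  qed (use P.sym R.sym P.nonneg R.nonneg P.measurable_Basis R.measurable_Basis in auto)
qed

lemma form_inner_add_form:
  assumes "measurable_psd_form M P" "measurable_psd_form M R"
    and "w \<in> form_L2 M P" "w \<in> form_L2 M R" "z \<in> form_L2 M P" "z \<in> form_L2 M R"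
  shows "form_inner M (\<lambda>x y z. P x y z + R x y z) w z = form_inner M P w z + form_inner M R w z"
  using assms by (simp add: form_inner_def measurable_psd_form.integrable_form)

text \<open>
  Both forms being nonnegative, each is dominated by their sum.
\<close>
lemma form_L2_add_form:
  assumes "measurable_psd_form M P" "measurable_psd_form M R"
  shows "form_L2 M (\<lambda>x y z. P x y z + R x y z) = form_L2 M P \<inter> form_L2 M R"
proof (intro equalityI subsetI IntI)
  interpret P: measurable_psd_form M P by fact
  interpret R: measurable_psd_form M R by fact
  fix w assume w: "w \<in> form_L2 M (\<lambda>x y z. P x y z + R x y z)"
  then have [measurable]: "w \<in> borel_measurable M" by (simp add: form_L2_def)
  have int: "integrable M (\<lambda>x. P x (w x) (w x) + R x (w x) (w x))"
    using w by (simp add: form_L2_def)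
  have "integrable M (\<lambda>x. P x (w x) (w x))" "integrable M (\<lambda>x. R x (w x) (w x))"
    using P.nonneg R.nonneg
    by (auto intro!: Bochner_Integration.integrable_bound[OF int] AE_I2 P.measurable_form R.measurable_form)
  then show "w \<in> form_L2 M P" "w \<in> form_L2 M R" by (auto simp: form_L2_def)
qed (use assms in \<open>auto simp: form_L2_def\<close>)

text \<open>
  The same sequence has to converge for both seminorms: this is the closure with respect to their sum.
\<close>
definition in_closure ::
    "'a measure \<Rightarrow> ('a \<Rightarrow> 'b::euclidean_space \<Rightarrow> 'b \<Rightarrow> real) \<Rightarrow> ('a \<Rightarrow> 'b \<Rightarrow> 'b \<Rightarrow> real) \<Rightarrow>
      ('a \<Rightarrow> 'b) set \<Rightarrow> ('a \<Rightarrow> 'b) \<Rightarrow> bool" where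
  "in_closure M P R V U \<longleftrightarrow> U \<in> form_L2 M P \<and> U \<in> form_L2 M R \<and>
     (\<exists>w. (\<forall>k. w k \<in> V) \<and> (\<lambda>k. form_dist2 M P U (w k)) \<longlonglongrightarrow> 0 \<and>
        (\<lambda>k. form_dist2 M R U (w k)) \<longlonglongrightarrow> 0)"

text \<open>
  The energy \<open>R(w, w) - 2 F w\<close> is minimised, and the limit is taken with respect to \<open>P + R\<close>, which is
  positive definite; the Poincare inequality transfers the Cauchy property from \<open>R\<close> to the sum.
\<close>
lemma weak_solution_exists:
  assumes P: "measurable_psd_form M P" and R: "measurable_psd_form M R"
    and pos: "AE x in M. \<forall>y. y \<noteq> 0 \<longrightarrow> 0 < P x y y + R x y y"
    and sub: "V \<subseteq> form_L2 M P \<inter> form_L2 M R" and ne: "V \<noteq> {}"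
    and comb: "\<And>w z c. w \<in> V \<Longrightarrow> z \<in> V \<Longrightarrow> (\<lambda>x. w x + c *\<^sub>R z x) \<in> V"
    and lin: "\<And>w z c. w \<in> V \<Longrightarrow> z \<in> V \<Longrightarrow> F (\<lambda>x. w x + c *\<^sub>R z x) = F w + c * F z"
    and poincare: "\<And>w. w \<in> V \<Longrightarrow> form_inner M P w w \<le> K * form_inner M R w w"
    and bound: "\<And>w. w \<in> V \<Longrightarrow> \<bar>F w\<bar> \<le> A + c * form_inner M R w w"
    and K: "0 \<le> K" and c: "0 < c"
  obtains U where "in_closure M P R V U" and "\<And>z. z \<in> V \<Longrightarrow> form_inner M R U z = F z"
proof -
  interpret P: measurable_psd_form M P by fact
  interpret R: measurable_psd_form M R by fact
  let ?S = "\<lambda>x y z. P x y z + R x y z"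
  interpret S: measurable_psd_form M ?S by (rule measurable_psd_form_add[OF P R])
  have VP: "z \<in> form_L2 M P" and VR: "z \<in> form_L2 M R" if "z \<in> V" for z
    using sub that by auto
  have VD: "(\<lambda>x. w x - z x) \<in> V" if "w \<in> V" "z \<in> V" for w z
    using comb[OF that, of "-1"] by simp
  have S_inner: "form_inner M ?S w w = form_inner M P w w + form_inner M R w w"
    if "w \<in> form_L2 M P" "w \<in> form_L2 M R" for w
    using form_inner_add_form[OF P R] that by blast
  have S_dist: "form_dist2 M ?S w z = form_dist2 M P w z + form_dist2 M R w z"
    if "w \<in> form_L2 M P" "w \<in> form_L2 M R" "z \<in> form_L2 M P" "z \<in> form_L2 M R" for w z
    unfolding form_dist2_def using that by (intro S_inner P.form_L2_diff R.form_L2_diff)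
  have below: "- (4 * A * c) \<le> form_inner M R w w - 2 * F w" if w: "w \<in> V" for w
  proof -
    \<comment> \<open>The bound on \<open>F\<close> is quadratic, so it is applied to \<open>t w\<close> and divided by \<open>t\<close>; this choice of \<open>t\<close>
    makes the quadratic term of \<open>2 F w\<close> exactly the form itself.\<close>
    define t where "t = 1 / (2 * c)"
    have t: "0 < t" using c by (simp add: t_def)
    have tw: "(\<lambda>x. w x + (t - 1) *\<^sub>R w x) \<in> V" by (rule comb[OF w w])
    have "F (\<lambda>x. w x + (t - 1) *\<^sub>R w x) = t * F w"
      by (subst lin[OF w w]) (simp add: algebra_simps)
    moreover have "form_inner M R (\<lambda>x. w x + (t - 1) *\<^sub>R w x) (\<lambda>x. w x + (t - 1) *\<^sub>R w x)
        = t\<^sup>2 * form_inner M R w w"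
      by (subst R.form_inner_comb_self[OF VR[OF w] VR[OF w]]) (simp add: algebra_simps power2_eq_square)
    ultimately have "\<bar>t * F w\<bar> \<le> A + c * (t\<^sup>2 * form_inner M R w w)"
      using bound[OF tw] by simp
    then have "t * F w \<le> A + c * (t\<^sup>2 * form_inner M R w w)" by linarith
    then show ?thesis using c by (simp add: t_def field_simps power2_eq_square)
  qed
  obtain w where w: "\<And>k. w k \<in> V"
    and w_F: "\<And>z. z \<in> V \<Longrightarrow> (\<lambda>k. form_inner M R (w k) z) \<longlonglongrightarrow> F z"
    and w_cauchy: "\<And>\<epsilon>. 0 < \<epsilon> \<Longrightarrow> \<exists>N. \<forall>k\<ge>N. \<forall>l\<ge>N. form_dist2 M R (w k) (w l) < \<epsilon>"
    using R.minimising_sequence[OF _ ne comb lin below] sub by (metis Int_subset_iff)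
  have S_cauchy: "\<exists>N. \<forall>k\<ge>N. \<forall>l\<ge>N. form_dist2 M ?S (w k) (w l) < \<epsilon>" if "0 < \<epsilon>" for \<epsilon>
  proof -
    obtain N where N: "\<And>k l. k \<ge> N \<Longrightarrow> l \<ge> N \<Longrightarrow> form_dist2 M R (w k) (w l) < \<epsilon> / (K + 1)"
      using w_cauchy[of "\<epsilon> / (K + 1)"] K \<open>0 < \<epsilon>\<close> by auto
    have "form_dist2 M ?S (w k) (w l) < \<epsilon>" if "k \<ge> N" "l \<ge> N" for k l
    proof -
      have "form_dist2 M ?S (w k) (w l) = form_dist2 M P (w k) (w l) + form_dist2 M R (w k) (w l)"
        by (intro S_dist VP VR w)
      also have "\<dots> \<le> (K + 1) * form_dist2 M R (w k) (w l)"
        using poincare[OF VD[OF w[of k] w[of l]]] by (simp add: form_dist2_def distrib_right)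
      also have "\<dots> < \<epsilon>" using N[OF that] K by (simp add: field_simps)
      finally show ?thesis .
    qed
    then show ?thesis by blast
  qed
  obtain U where U: "U \<in> form_L2 M ?S" and lim: "(\<lambda>k. form_dist2 M ?S U (w k)) \<longlonglongrightarrow> 0"
    using S.form_L2_complete[OF _ pos S_cauchy] w sub form_L2_add_form[OF P R] by blast
  have UP: "U \<in> form_L2 M P" and UR: "U \<in> form_L2 M R"
    using U form_L2_add_form[OF P R] by auto
  have dist: "form_dist2 M ?S U (w k) = form_dist2 M P U (w k) + form_dist2 M R U (w k)" for k
    by (intro S_dist UP UR VP VR w)
  have limP: "(\<lambda>k. form_dist2 M P U (w k)) \<longlonglongrightarrow> 0"
    by (rule tendsto_sandwich[OF _ _ tendsto_const lim])
      (simp_all add: dist P.form_dist2_nonneg R.form_dist2_nonneg)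
  have limR: "(\<lambda>k. form_dist2 M R U (w k)) \<longlonglongrightarrow> 0"
    by (rule tendsto_sandwich[OF _ _ tendsto_const lim])
      (simp_all add: dist P.form_dist2_nonneg R.form_dist2_nonneg)
  show thesis
  proof (rule that)
    show "in_closure M P R V U"
      unfolding in_closure_def using UP UR w limP limR by blast
    show "form_inner M R U z = F z" if "z \<in> V" for z
      using R.form_inner_tendsto[OF UR VR[OF w] VR[OF that] limR] w_F[OF that]
      by (rule LIMSEQ_unique)
  qed
qed

text \<open>
  The difference \<open>D\<close> is \<open>R\<close>-orthogonal to \<open>V\<close> and a limit of elements \<open>d\<^sub>k\<close> of \<open>V\<close>, so
  \<open>R(D, D) = lim R(d\<^sub>k, D) = 0\<close>. Then \<open>R(d\<^sub>k, d\<^sub>k) \<rightarrow> 0\<close>, by the Poincare inequality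
  \<open>P(d\<^sub>k, d\<^sub>k) \<rightarrow> 0\<close>, and so \<open>P(D, D) = 0\<close>.
\<close>
lemma weak_solution_unique:
  assumes P: "measurable_psd_form M P" and R: "measurable_psd_form M R"
    and pos: "AE x in M. \<forall>y. y \<noteq> 0 \<longrightarrow> 0 < P x y y + R x y y"
    and sub: "V \<subseteq> form_L2 M P \<inter> form_L2 M R"
    and comb: "\<And>w z c. w \<in> V \<Longrightarrow> z \<in> V \<Longrightarrow> (\<lambda>x. w x + c *\<^sub>R z x) \<in> V"
    and poincare: "\<And>w. w \<in> V \<Longrightarrow> form_inner M P w w \<le> K * form_inner M R w w"
    and U: "in_closure M P R V U" "\<And>z. z \<in> V \<Longrightarrow> form_inner M R U z = F z"
    and U': "in_closure M P R V U'" "\<And>z. z \<in> V \<Longrightarrow> form_inner M R U' z = F z"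
  shows "AE x in M. U' x = U x"
proof -
  interpret P: measurable_psd_form M P by fact
  interpret R: measurable_psd_form M R by fact
  have VP: "z \<in> form_L2 M P" and VR: "z \<in> form_L2 M R" if "z \<in> V" for z
    using sub that by auto
  obtain w where UPR: "U \<in> form_L2 M P" "U \<in> form_L2 M R" and w: "\<And>k. w k \<in> V"
    and limP: "(\<lambda>k. form_dist2 M P U (w k)) \<longlonglongrightarrow> 0"
    and limR: "(\<lambda>k. form_dist2 M R U (w k)) \<longlonglongrightarrow> 0"
    using U(1) unfolding in_closure_def by blast
  obtain w' where UPR': "U' \<in> form_L2 M P" "U' \<in> form_L2 M R" and w': "\<And>k. w' k \<in> V"
    and limP': "(\<lambda>k. form_dist2 M P U' (w' k)) \<longlonglongrightarrow> 0"
    and limR': "(\<lambda>k. form_dist2 M R U' (w' k)) \<longlonglongrightarrow> 0"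
    using U'(1) unfolding in_closure_def by blast
  define D where "D = (\<lambda>x. U x - U' x)"
  define d where "d k = (\<lambda>x. w k x - w' k x)" for k
  have d: "d k \<in> V" for k using comb[OF w[of k] w'[of k], of "-1"] by (simp add: d_def)
  have DP: "D \<in> form_L2 M P" and DR: "D \<in> form_L2 M R"
    unfolding D_def using UPR UPR' by (auto intro: P.form_L2_diff R.form_L2_diff)
  have limd: "(\<lambda>k. form_dist2 M B D (d k)) \<longlonglongrightarrow> 0"
    if B: "measurable_psd_form M B" and V: "\<And>z. z \<in> V \<Longrightarrow> z \<in> form_L2 M B"
      and UB: "U \<in> form_L2 M B" "U' \<in> form_L2 M B"
      and l: "(\<lambda>k. form_dist2 M B U (w k)) \<longlonglongrightarrow> 0" "(\<lambda>k. form_dist2 M B U' (w' k)) \<longlonglongrightarrow> 0" for B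
  proof -
    interpret B: measurable_psd_form M B by fact
    have le: "form_dist2 M B D (d k) \<le> 2 * form_dist2 M B U (w k) + 2 * form_dist2 M B U' (w' k)" for k
    proof -
      have "(\<lambda>x. D x - d k x) = (\<lambda>x. (U x - w k x) + (w' k x - U' x))"
        by (simp add: D_def d_def algebra_simps)
      then have "form_dist2 M B D (d k) \<le> 2 * form_dist2 M B U (w k) + 2 * form_dist2 M B (w' k) U'"
        unfolding form_dist2_def
        using B.form_inner_add_le[OF B.form_L2_diff[OF UB(1) V[OF w]] B.form_L2_diff[OF V[OF w'] UB(2)]]
        by simp
      moreover have "form_dist2 M B (w' k) U' = form_dist2 M B U' (w' k)"
        using B.form_inner_comb_self[OF B.form_L2_diff[OF UB(2) V[OF w'[of k]]] B.form_L2_diff[OF UB(2) V[OF w'[of k]]], of "-2"]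
        by (simp add: form_dist2_def algebra_simps scaleR_2)
      ultimately show ?thesis by simp
    qed
    have lim: "(\<lambda>k. 2 * form_dist2 M B U (w k) + 2 * form_dist2 M B U' (w' k)) \<longlonglongrightarrow> 0"
      using tendsto_add[OF tendsto_mult_right_zero[OF l(1), of 2] tendsto_mult_right_zero[OF l(2), of 2]]
      by simp
    show ?thesis
      by (rule tendsto_sandwich[OF _ _ tendsto_const lim]) (simp_all add: B.form_dist2_nonneg le)
  qed
  have limdP: "(\<lambda>k. form_dist2 M P D (d k)) \<longlonglongrightarrow> 0"
    by (rule limd[OF P VP UPR(1) UPR'(1) limP limP'])
  have limdR: "(\<lambda>k. form_dist2 M R D (d k)) \<longlonglongrightarrow> 0"
    by (rule limd[OF R VR UPR(2) UPR'(2) limR limR'])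
  have orth: "form_inner M R D z = 0" if "z \<in> V" for z
    unfolding D_def using R.form_inner_diff[OF UPR(2) UPR'(2) VR[OF that]] U(2) U'(2) that by simp
  have R0: "form_inner M R D D = 0"
  proof -
    have "(\<lambda>k. form_inner M R (d k) D) \<longlonglongrightarrow> form_inner M R D D"
      by (rule R.form_inner_tendsto[OF DR VR[OF d] DR limdR])
    moreover have "form_inner M R (d k) D = 0" for k
      using orth[OF d] R.form_inner_sym by metis
    ultimately show ?thesis by (simp add: LIMSEQ_const_iff)
  qed
  have dR: "form_inner M R (d k) (d k) \<le> form_dist2 M R D (d k)" for k
  proof -
    have "form_dist2 M R D (d k) = form_inner M R D D - 2 * form_inner M R D (d k) + form_inner M R (d k) (d k)"
      using R.form_inner_comb_self[OF DR VR[OF d[of k]], of "-1"] by (simp add: form_dist2_def)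
    then show ?thesis using R0 orth[OF d] by simp
  qed
  have P0: "form_inner M P D D = 0"
  proof -
    have le: "form_inner M P D D \<le> 2 * form_dist2 M P D (d k) + 2 * (\<bar>K\<bar> * form_dist2 M R D (d k))" for k
    proof -
      have "form_inner M P (d k) (d k) \<le> \<bar>K\<bar> * form_dist2 M R D (d k)"
        using poincare[OF d[of k]] dR[of k] R.form_inner_nonneg[of "d k"]
        by (meson abs_ge_self abs_ge_zero mult_mono order_trans)
      then show ?thesis
        using P.form_inner_add_le[OF P.form_L2_diff[OF DP VP[OF d[of k]]] VP[OF d[of k]]]
        by (simp add: form_dist2_def)
    qed
    have lim: "(\<lambda>k. 2 * form_dist2 M P D (d k) + 2 * (\<bar>K\<bar> * form_dist2 M R D (d k))) \<longlonglongrightarrow> 0"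
      using tendsto_add[OF tendsto_mult_right_zero[OF limdP, of 2]
          tendsto_mult_right_zero[OF tendsto_mult_right_zero[OF limdR, of "\<bar>K\<bar>"], of 2]]
      by simp
    have "form_inner M P D D \<le> 0"
      using LIMSEQ_le_const[OF lim] le by blast
    then show ?thesis using P.form_inner_nonneg[of D] by simp
  qed
  have "AE x in M. P x (D x) (D x) = 0"
    using P0 P.integrable_form[OF DP DP] P.nonneg
    by (subst (asm) form_inner_def, subst (asm) integral_nonneg_eq_0_iff_AE) auto
  moreover have "AE x in M. R x (D x) (D x) = 0"
    using R0 R.integrable_form[OF DR DR] R.nonneg
    by (subst (asm) form_inner_def, subst (asm) integral_nonneg_eq_0_iff_AE) auto
  ultimately show ?thesis
    using pos
  proof eventually_elim
    case (elim x)
    then have "D x = 0" using less_irrefl by fastforce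
    then show ?case by (simp add: D_def)
  qed
qed

section \<open>Measurability of almost-everywhere gradients\<close>

lemma gderiv_difference_quotient:
  fixes f :: "'a::real_inner \<Rightarrow> real"
  assumes "GDERIV f x :> g"
  shows "(\<lambda>k. (f (x + inverse (real (Suc k)) *\<^sub>R i) - f x) / inverse (real (Suc k)))
    \<longlonglongrightarrow> g \<bullet> i"
proof -
  have "((\<lambda>t. f (x + t *\<^sub>R i)) has_derivative (\<lambda>t. (t *\<^sub>R i) \<bullet> g)) (at (0::real))"
    by (rule has_derivative_compose[where g = f and f = "\<lambda>t. x + t *\<^sub>R i"])
      (use assms in \<open>auto simp: gderiv_def intro!: derivative_eq_intros\<close>)
  moreover have "(\<lambda>t. (t *\<^sub>R i) \<bullet> g) = (*) (g \<bullet> i)"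
    by (simp add: fun_eq_iff inner_commute)
  ultimately have "((\<lambda>t. f (x + t *\<^sub>R i)) has_field_derivative g \<bullet> i) (at 0)"
    by (simp add: has_field_derivative_def)
  then have "((\<lambda>h. (f (x + h *\<^sub>R i) - f x) / h) \<longlongrightarrow> g \<bullet> i) (at 0)"
    by (simp add: DERIV_def)
  moreover have "filterlim (\<lambda>k. inverse (real (Suc k))) (at 0) sequentially"
    using LIMSEQ_inverse_real_of_nat by (simp add: filterlim_at)
  ultimately show ?thesis by (rule filterlim_compose)
qed

lemma borel_measurable_lebesgue_on_AE:
  fixes f g :: "'a::euclidean_space \<Rightarrow> 'b::euclidean_space"
  assumes S: "S \<in> sets lebesgue" and f: "f \<in> borel_measurable (lebesgue_on S)"
    and eq: "AE x in lebesgue_on S. f x = g x"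
  shows "g \<in> borel_measurable (lebesgue_on S)"
proof -
  have "(\<lambda>x. if x \<in> S then g x else 0) \<in> borel_measurable lebesgue"
  proof (rule borel_measurable_AE)
    show "(\<lambda>x. if x \<in> S then f x else 0) \<in> borel_measurable lebesgue"
      using f S by (simp add: borel_measurable_if)
    have "AE x in lebesgue. x \<in> S \<longrightarrow> f x = g x"
      using eq S by (simp add: AE_restrict_space_iff)
    then show "AE x in lebesgue. (if x \<in> S then f x else 0) = (if x \<in> S then g x else 0)"
      by eventually_elim auto
  qed
  then show ?thesis using S by (simp add: borel_measurable_if)
qed

text \<open>
  Almost everywhere \<open>G\<close> is a limit of difference quotients of \<open>\<phi>\<close>, extended by zero because \<open>\<phi>\<close> is
  controlled on \<open>\<Omega>\<close> only; Lebesgue measure is complete, so the exceptional null set is harmless.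
\<close>
lemma ae_gradient_measurable:
  fixes \<phi> :: "real^'n \<Rightarrow> real"
  assumes op: "open \<Omega>" and cont: "continuous_on \<Omega> \<phi>" and grad: "ae_gradient \<Omega> \<phi> G"
  shows "G \<in> borel_measurable (lebesgue_on \<Omega>)"
proof -
  have sets: "\<Omega> \<in> sets lebesgue" using op by simp
  define \<psi> where "\<psi> x = indicator \<Omega> x *\<^sub>R \<phi> x" for x
  have psi[measurable]: "\<psi> \<in> borel_measurable borel"
    unfolding \<psi>_def using op cont by (intro borel_measurable_continuous_on_indicator) auto
  define q where "q i k x = (\<psi> (x + inverse (real (Suc k)) *\<^sub>R i) - \<psi> x) / inverse (real (Suc k))"
    for i :: "real^'n" and k x
  have q: "q i k \<in> borel_measurable (lebesgue_on \<Omega>)" for i k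
  proof (rule measurable_restrict_space1, rule measurable_completion)
    show "q i k \<in> borel_measurable lborel"
      unfolding q_def by measurable
  qed
  define H where "H x = (\<Sum>i\<in>Basis. lim (\<lambda>k. q i k x) *\<^sub>R i)" for x
  have "H \<in> borel_measurable (lebesgue_on \<Omega>)"
    unfolding H_def
    by (intro borel_measurable_sum borel_measurable_scaleR borel_measurable_const
        borel_measurable_lim_metric q)
  moreover have "AE x in lebesgue_on \<Omega>. H x = G x"
    using grad[unfolded ae_gradient_def] AE_space
  proof eventually_elim
    case (elim x)
    have x: "x \<in> \<Omega>" using elim(2) by (simp add: space_restrict_space)
    have "GDERIV \<psi> x :> G x"
      using elim(1) unfolding gderiv_def
      by (rule has_derivative_transform_within_open[OF _ op x]) (simp add: \<psi>_def)
    from gderiv_difference_quotient[OF this] have "lim (\<lambda>k. q i k x) = G x \<bullet> i" for i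
      unfolding q_def by (rule limI)
    then show ?case by (simp add: H_def euclidean_representation)
  qed
  ultimately show ?thesis using borel_measurable_lebesgue_on_AE[OF sets] by blast
qed

section \<open>The weighted Sobolev space as a closure\<close>

text \<open>
  Both norms become forms on \<open>\<real> \<times> \<real>\<^sup>n\<close>, each degenerate in the other component. For a pair
  \<open>(u, g)\<close> they give \<open>v u\<^sup>2\<close> and \<open>|\<surd>Q g|\<^sup>2\<close>.
\<close>
definition weight_form ::
    "(real^'n \<Rightarrow> real) \<Rightarrow> real^'n \<Rightarrow> real \<times> (real^'n) \<Rightarrow> real \<times> (real^'n) \<Rightarrow> real" where
  "weight_form v x y z = v x * fst y * fst z"

definition matrix_form ::
    "(real^'n \<Rightarrow> real^'n^'n) \<Rightarrow> real^'n \<Rightarrow> real \<times> (real^'n) \<Rightarrow> real \<times> (real^'n) \<Rightarrow> real" where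
  "matrix_form Q x y z = (Q x *v snd y) \<bullet> snd z"

lemma Lip0_comb:
  assumes "\<phi> \<in> Lip0 \<Omega>" "\<psi> \<in> Lip0 \<Omega>"
  shows "(\<lambda>x. \<phi> x + c * \<psi> x) \<in> Lip0 \<Omega>"
proof -
  let ?S = "\<lambda>f. {x\<in>\<Omega>. f x \<noteq> (0::real)}"
  have "closure (?S (\<lambda>x. \<phi> x + c * \<psi> x)) \<subseteq> closure (?S \<phi> \<union> ?S \<psi>)"
    by (rule closure_mono) auto
  then have sub: "closure (?S (\<lambda>x. \<phi> x + c * \<psi> x)) \<subseteq> closure (?S \<phi>) \<union> closure (?S \<psi>)"
    by simp
  obtain L L' where "L-lipschitz_on \<Omega> \<phi>" "L'-lipschitz_on \<Omega> \<psi>"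
    using assms by (auto simp: Lip0_def)
  then have "(L + \<bar>c\<bar> * L')-lipschitz_on \<Omega> (\<lambda>x. \<phi> x + c * \<psi> x)"
    by (intro lipschitz_on_add lipschitz_on_cmult_real)
  moreover have "bounded (?S (\<lambda>x. \<phi> x + c * \<psi> x))"
  proof (rule bounded_subset)
    show "bounded (?S \<phi> \<union> ?S \<psi>)" using assms by (simp add: Lip0_def)
  qed auto
  ultimately show ?thesis
    using assms sub unfolding Lip0_def by auto
qed

lemma ae_gradient_comb:
  assumes "ae_gradient \<Omega> \<phi> G" "ae_gradient \<Omega> \<psi> H"
  shows "ae_gradient \<Omega> (\<lambda>x. \<phi> x + c * \<psi> x) (\<lambda>x. G x + c *\<^sub>R H x)"
  using assms unfolding ae_gradient_def
proof eventually_elim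
  case (elim x)
  show ?case
    using GDERIV_add[OF elim(1) GDERIV_mult[OF GDERIV_const[of c] elim(2)]] by simp
qed

lemma ennreal_sqrt_eq_top_iff: "ennreal_sqrt t = top \<longleftrightarrow> t = top"
  by (simp add: ennreal_sqrt_def)

lemma ennreal_sqrt_ennreal: "0 \<le> r \<Longrightarrow> ennreal_sqrt (ennreal r) = ennreal (sqrt r)"
  by (simp add: ennreal_sqrt_def)

locale weighted_domain =
  fixes \<Omega> :: "(real^'n) set" and v :: "real^'n \<Rightarrow> real" and Q :: "real^'n \<Rightarrow> real^'n^'n"
  assumes open_domain: "open \<Omega>" and weight: "weight \<Omega> v" and matrix: "matrix_function \<Omega> Q"
begin

abbreviation "M \<equiv> lebesgue_on \<Omega>"
abbreviation "P \<equiv> weight_form v"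
abbreviation "R \<equiv> matrix_form Q"

lemma space_M: "space M = \<Omega>" by (simp add: space_restrict_space)

lemma v_measurable[measurable]: "v \<in> borel_measurable M"
  and v_nonneg: "x \<in> \<Omega> \<Longrightarrow> 0 \<le> v x"
  and v_pos: "AE x in M. 0 < v x"
  using weight by (auto simp: weight_def)

lemma Q_psd: "x \<in> \<Omega> \<Longrightarrow> psd_matrix (Q x)"
  and Q_measurable[measurable]: "(\<lambda>x. Q x $ i $ j) \<in> borel_measurable M"
  and Q_invertible: "AE x in M. invertible (Q x)"
  using matrix by (auto simp: matrix_function_def)

lemma P_form: "measurable_psd_form M P"
proof
  show "bilinear (P x)" for x
    by (auto simp: bilinear_def linear_iff weight_form_def algebra_simps)
qed (auto simp: weight_form_def space_M v_nonneg mult.assoc mult_nonneg_nonneg)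

lemma R_form: "measurable_psd_form M R"
proof
  show "bilinear (R x)" for x
    by (auto simp: bilinear_def linear_iff matrix_form_def matrix_vector_right_distrib
        inner_add_left inner_add_right matrix_vector_mult_scaleR)
  show "R x y z = R x z y" if "x \<in> space M" for x y z
    using psd_matrix_symmetric[OF Q_psd] that by (simp add: matrix_form_def space_M)
  show "0 \<le> R x y y" if "x \<in> space M" for x y
    using Q_psd[of x] that by (simp add: matrix_form_def space_M psd_matrix_def)
  show "(\<lambda>x. R x y z) \<in> borel_measurable M" for y z
    unfolding matrix_form_def inner_vec_def matrix_vector_mult_def by simp
qed

sublocale P: measurable_psd_form M P by (rule P_form)
sublocale R: measurable_psd_form M R by (rule R_form)

lemma form_posdef: "AE x in M. \<forall>y. y \<noteq> 0 \<longrightarrow> 0 < P x y y + R x y y"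
  using v_pos Q_invertible AE_space
proof eventually_elim
  case (elim x)
  then have x: "x \<in> \<Omega>" by (simp add: space_M)
  show ?case
  proof (intro allI impI)
    fix y :: "real \<times> (real^'n)" assume "y \<noteq> 0"
    then consider "fst y \<noteq> 0" | "snd y \<noteq> 0" by (metis prod_eqI fst_zero snd_zero)
    then show "0 < P x y y + R x y y"
    proof cases
      case 1
      then have "0 < P x y y" using elim(1) by (auto simp: weight_form_def mult.assoc zero_less_mult_iff linorder_neq_iff)
      then show ?thesis using R.nonneg[of x y] x by (simp add: space_M)
    next
      case 2
      then have "0 < R x y y" using psd_invertible_posdef[OF Q_psd[OF x] elim(2)] by (simp add: matrix_form_def)
      then show ?thesis using P.nonneg[of x y] x by (simp add: space_M)
    qed
  qed
qed

lemma nn_integral_weight: "(\<integral>\<^sup>+ x. ennreal (\<bar>u x\<bar>\<^sup>2 * v x) \<partial>M) = (\<integral>\<^sup>+ x. ennreal (P x (u x, g x) (u x, g x)) \<partial>M)"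
  by (intro nn_integral_cong) (simp add: weight_form_def power2_eq_square ac_simps)

lemma nn_integral_matrix_sqrt:
  "(\<integral>\<^sup>+ x. ennreal ((norm (matrix_sqrt (Q x) *v g x))\<^sup>2) \<partial>M) = (\<integral>\<^sup>+ x. ennreal (R x (u x, g x) (u x, g x)) \<partial>M)"
proof (rule nn_integral_cong_AE)
  show "AE x in M. ennreal ((norm (matrix_sqrt (Q x) *v g x))\<^sup>2) = ennreal (R x (u x, g x) (u x, g x))"
    using Q_invertible AE_space
    by eventually_elim (simp add: matrix_form_def norm_matrix_sqrt_mult Q_psd space_M)
qed

lemma norm_L2_eq:
  assumes "(\<lambda>x. (u x, g x)) \<in> form_L2 M P"
  shows "norm_L2 v \<Omega> u = ennreal (sqrt (form_inner M P (\<lambda>x. (u x, g x)) (\<lambda>x. (u x, g x))))"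
  unfolding norm_L2_def nn_integral_weight[of u g] P.nn_integral_form[OF assms]
  by (rule ennreal_sqrt_ennreal[OF P.form_inner_nonneg])

lemma norm_QL2_eq:
  assumes "(\<lambda>x. (u x, g x)) \<in> form_L2 M R"
  shows "norm_QL2 Q \<Omega> g = ennreal (sqrt (form_inner M R (\<lambda>x. (u x, g x)) (\<lambda>x. (u x, g x))))"
  unfolding norm_QL2_def nn_integral_matrix_sqrt[of g u] R.nn_integral_form[OF assms]
  by (rule ennreal_sqrt_ennreal[OF R.form_inner_nonneg])

lemma pair_form_L2_iff:
  assumes [measurable]: "u \<in> borel_measurable M" "g \<in> borel_measurable M"
  shows "(\<lambda>x. (u x, g x)) \<in> form_L2 M P \<longleftrightarrow> norm_L2 v \<Omega> u < \<infinity>"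
    and "(\<lambda>x. (u x, g x)) \<in> form_L2 M R \<longleftrightarrow> norm_QL2 Q \<Omega> g < \<infinity>"
proof -
  have m: "(\<lambda>x. (u x, g x)) \<in> borel_measurable M" by measurable
  show "(\<lambda>x. (u x, g x)) \<in> form_L2 M P \<longleftrightarrow> norm_L2 v \<Omega> u < \<infinity>"
    using P.form_L2_iff[OF m]
    unfolding norm_L2_def nn_integral_weight[of u g]
    by (simp add: less_top[symmetric] ennreal_sqrt_eq_top_iff)
  show "(\<lambda>x. (u x, g x)) \<in> form_L2 M R \<longleftrightarrow> norm_QL2 Q \<Omega> g < \<infinity>"
    using R.form_L2_iff[OF m]
    unfolding norm_QL2_def nn_integral_matrix_sqrt[of g u]
    by (simp add: less_top[symmetric] ennreal_sqrt_eq_top_iff)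
qed

lemma pair_in_form_L2:
  "(\<lambda>x. (u x, g x)) \<in> form_L2 M P \<inter> form_L2 M R \<longleftrightarrow> u \<in> L2 v \<Omega> \<and> g \<in> QL2 Q \<Omega>"
proof (cases "(\<lambda>x. (u x, g x)) \<in> borel_measurable M")
  case True
  have "fst \<in> borel_measurable (borel :: (real \<times> (real^'n)) measure)"
    "snd \<in> borel_measurable (borel :: (real \<times> (real^'n)) measure)"
    by (intro borel_measurable_continuous_onI continuous_intros)+
  from this[THEN measurable_compose[OF True]]
  have "u \<in> borel_measurable M" "g \<in> borel_measurable M" by simp_all
  then show ?thesis by (simp add: pair_form_L2_iff L2_def QL2_def)
next
  case False
  then show ?thesis
    by (auto simp: form_L2_def L2_def QL2_def)
qed

definition test_pairs :: "(real^'n \<Rightarrow> real \<times> (real^'n)) set" where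
  "test_pairs = (\<lambda>(\<phi>, G) x. (\<phi> x, G x)) ` QLip0_pairs v Q \<Omega>"

text \<open>
  Finiteness of the norms alone does not give membership in the spaces of square-integrable functions;
  the measurability of the gradient representative is what is added here.
\<close>
lemma QLip0_pairs_iff:
  "(\<phi>, G) \<in> QLip0_pairs v Q \<Omega> \<longleftrightarrow> \<phi> \<in> Lip0 \<Omega> \<and> ae_gradient \<Omega> \<phi> G \<and>
     (\<lambda>x. (\<phi> x, G x)) \<in> form_L2 M P \<inter> form_L2 M R"
proof (cases "\<phi> \<in> Lip0 \<Omega> \<and> ae_gradient \<Omega> \<phi> G")
  case True
  then obtain L where "L-lipschitz_on \<Omega> \<phi>" by (auto simp: Lip0_def)
  then have cont: "continuous_on \<Omega> \<phi>" by (rule lipschitz_on_continuous_on)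
  have \<phi>: "\<phi> \<in> borel_measurable M"
    using open_domain cont by (intro continuous_imp_measurable_on_sets_lebesgue) auto
  have G: "G \<in> borel_measurable M"
    using ae_gradient_measurable[OF open_domain cont] True by blast
  show ?thesis
    using True by (simp add: QLip0_pairs_def pair_form_L2_iff[OF \<phi> G])
qed (auto simp: QLip0_pairs_def)

lemma test_pairs_form_L2: "test_pairs \<subseteq> form_L2 M P \<inter> form_L2 M R"
  unfolding test_pairs_def using QLip0_pairs_iff by auto

lemma test_pairs_comb:
  assumes "w \<in> test_pairs" "z \<in> test_pairs"
  shows "(\<lambda>x. w x + c *\<^sub>R z x) \<in> test_pairs"
proof -
  obtain \<phi> G where w: "w = (\<lambda>x. (\<phi> x, G x))" "(\<phi>, G) \<in> QLip0_pairs v Q \<Omega>"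
    using assms(1) by (auto simp: test_pairs_def)
  obtain \<psi> H where z: "z = (\<lambda>x. (\<psi> x, H x))" "(\<psi>, H) \<in> QLip0_pairs v Q \<Omega>"
    using assms(2) by (auto simp: test_pairs_def)
  have eq: "(\<lambda>x. w x + c *\<^sub>R z x) = (\<lambda>x. (\<phi> x + c * \<psi> x, G x + c *\<^sub>R H x))"
    by (simp add: w z)
  have "(\<lambda>x. w x + c *\<^sub>R z x) \<in> form_L2 M P \<inter> form_L2 M R"
    using assms test_pairs_form_L2 by (auto intro: P.form_L2_comb R.form_L2_comb)
  then have "(\<lambda>x. \<phi> x + c * \<psi> x, \<lambda>x. G x + c *\<^sub>R H x) \<in> QLip0_pairs v Q \<Omega>"
    using w(2) z(2) unfolding QLip0_pairs_iff eq by (auto intro: Lip0_comb ae_gradient_comb)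
  then show ?thesis unfolding eq test_pairs_def by force
qed

lemma zero_test_pair: "(\<lambda>x. (0, 0)) \<in> test_pairs"
proof -
  have "(\<lambda>x. 0) \<in> Lip0 \<Omega>" by (auto simp: Lip0_def intro!: exI[of _ 0] lipschitz_onI)
  moreover have "ae_gradient \<Omega> (\<lambda>x. 0) (\<lambda>x. 0)" by (simp add: ae_gradient_def GDERIV_const)
  moreover have "(\<lambda>x. (0, 0)) \<in> form_L2 M P \<inter> form_L2 M R"
    by (simp add: form_L2_def weight_form_def matrix_form_def)
  ultimately have "(\<lambda>x. 0, \<lambda>x. 0) \<in> QLip0_pairs v Q \<Omega>" by (simp add: QLip0_pairs_iff)
  then show ?thesis unfolding test_pairs_def by force
qed

text \<open>
  The sum of the two norms is small exactly when both squared distances are, which turns the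
  \<open>\<epsilon>\<close>-formulation of the closure into convergence of a sequence.
\<close>
lemma QH0_iff_in_closure: "(u, g) \<in> QH0 v Q \<Omega> \<longleftrightarrow> in_closure M P R test_pairs (\<lambda>x. (u x, g x))"
proof (cases "u \<in> L2 v \<Omega> \<and> g \<in> QL2 Q \<Omega>")
  case True
  then have U: "(\<lambda>x. (u x, g x)) \<in> form_L2 M P" "(\<lambda>x. (u x, g x)) \<in> form_L2 M R"
    using pair_in_form_L2 by blast+
  let ?U = "\<lambda>x. (u x, g x)"
  have dist: "norm_L2 v \<Omega> (\<lambda>x. u x - \<phi> x) + norm_QL2 Q \<Omega> (\<lambda>x. g x - G x)
      = ennreal (sqrt (form_dist2 M P ?U (\<lambda>x. (\<phi> x, G x))) + sqrt (form_dist2 M R ?U (\<lambda>x. (\<phi> x, G x))))"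
    if "(\<phi>, G) \<in> QLip0_pairs v Q \<Omega>" for \<phi> G
  proof -
    have *: "(\<lambda>x. (\<phi> x, G x)) \<in> form_L2 M P" "(\<lambda>x. (\<phi> x, G x)) \<in> form_L2 M R"
      using that by (auto simp: QLip0_pairs_iff)
    have "(\<lambda>x. (u x - \<phi> x, g x - G x)) \<in> form_L2 M P" "(\<lambda>x. (u x - \<phi> x, g x - G x)) \<in> form_L2 M R"
      using P.form_L2_diff[OF U(1) *(1)] R.form_L2_diff[OF U(2) *(2)] by simp_all
    from norm_L2_eq[OF this(1)] norm_QL2_eq[OF this(2)] show ?thesis
      using P.form_inner_nonneg R.form_inner_nonneg by (simp add: form_dist2_def)
  qed
  have QH0: "(u, g) \<in> QH0 v Q \<Omega> \<longleftrightarrow> (\<forall>\<epsilon>>0. \<exists>w\<in>test_pairs.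
      sqrt (form_dist2 M P ?U w) + sqrt (form_dist2 M R ?U w) < \<epsilon>)"
  proof -
    have "(\<exists>(\<phi>, G)\<in>QLip0_pairs v Q \<Omega>.
          norm_L2 v \<Omega> (\<lambda>x. u x - \<phi> x) + norm_QL2 Q \<Omega> (\<lambda>x. g x - G x) < ennreal \<epsilon>) \<longleftrightarrow>
        (\<exists>w\<in>test_pairs. sqrt (form_dist2 M P ?U w) + sqrt (form_dist2 M R ?U w) < \<epsilon>)" for \<epsilon>
      unfolding test_pairs_def bex_simps(7)
    proof (rule bex_cong[OF refl])
      fix p assume "p \<in> QLip0_pairs v Q \<Omega>"
      moreover obtain \<phi> G where p: "p = (\<phi>, G)" by (cases p)
      ultimately have "(\<phi>, G) \<in> QLip0_pairs v Q \<Omega>" by simp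
      from dist[OF this] show "(case p of (\<phi>, G) \<Rightarrow>
            norm_L2 v \<Omega> (\<lambda>x. u x - \<phi> x) + norm_QL2 Q \<Omega> (\<lambda>x. g x - G x) < ennreal \<epsilon>) \<longleftrightarrow>
          sqrt (form_dist2 M P ?U (case p of (\<phi>, G) \<Rightarrow> \<lambda>x. (\<phi> x, G x))) +
          sqrt (form_dist2 M R ?U (case p of (\<phi>, G) \<Rightarrow> \<lambda>x. (\<phi> x, G x))) < \<epsilon>"
        by (simp add: p ennreal_less_iff P.form_dist2_nonneg R.form_dist2_nonneg
            del: ennreal_plus)
    qed
    then show ?thesis using True by (simp add: QH0_def)
  qed
  show ?thesis
  proof
    assume "(u, g) \<in> QH0 v Q \<Omega>"
    then have "\<forall>k. \<exists>w. w \<in> test_pairs \<and>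
        sqrt (form_dist2 M P ?U w) + sqrt (form_dist2 M R ?U w) < inverse (real (Suc k))"
      unfolding QH0 Bex_def by simp
    from choice[OF this] obtain w where w: "\<And>k. w k \<in> test_pairs"
      "\<And>k. sqrt (form_dist2 M P ?U (w k)) + sqrt (form_dist2 M R ?U (w k)) < inverse (real (Suc k))"
      by blast
    have lim: "d \<longlonglongrightarrow> 0" if "\<And>k. 0 \<le> d k" "\<And>k. sqrt (d k) \<le> inverse (real (Suc k))" for d :: "nat \<Rightarrow> real"
    proof -
      have "(\<lambda>k. sqrt (d k)) \<longlonglongrightarrow> 0"
        by (rule tendsto_sandwich[OF _ _ tendsto_const LIMSEQ_inverse_real_of_nat]) (use that in auto)
      from tendsto_power[OF this, of 2] show ?thesis using that(1) by simp
    qed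
    have "sqrt (form_dist2 M P ?U (w k)) \<le> inverse (real (Suc k))"
      "sqrt (form_dist2 M R ?U (w k)) \<le> inverse (real (Suc k))" for k
      using w(2)[of k] real_sqrt_ge_zero[OF P.form_dist2_nonneg[of ?U "w k"]]
        real_sqrt_ge_zero[OF R.form_dist2_nonneg[of ?U "w k"]] by linarith+
    then have "(\<lambda>k. form_dist2 M P ?U (w k)) \<longlonglongrightarrow> 0" "(\<lambda>k. form_dist2 M R ?U (w k)) \<longlonglongrightarrow> 0"
      by (auto intro!: lim P.form_dist2_nonneg R.form_dist2_nonneg)
    then show "in_closure M P R test_pairs ?U"
      unfolding in_closure_def using U w(1) by blast
  next
    assume "in_closure M P R test_pairs ?U"
    then obtain w where w: "\<And>k. w k \<in> test_pairs"
      and lim: "(\<lambda>k. form_dist2 M P ?U (w k)) \<longlonglongrightarrow> 0" "(\<lambda>k. form_dist2 M R ?U (w k)) \<longlonglongrightarrow> 0"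
      unfolding in_closure_def by blast
    have "(\<lambda>k. sqrt (form_dist2 M P ?U (w k)) + sqrt (form_dist2 M R ?U (w k))) \<longlonglongrightarrow> sqrt 0 + sqrt 0"
      by (intro tendsto_add tendsto_real_sqrt lim)
    then have lim': "(\<lambda>k. sqrt (form_dist2 M P ?U (w k)) + sqrt (form_dist2 M R ?U (w k))) \<longlonglongrightarrow> 0" by simp
    show "(u, g) \<in> QH0 v Q \<Omega>"
      unfolding QH0
    proof (intro allI impI)
      fix \<epsilon> :: real assume "0 < \<epsilon>"
      from order_tendstoD(2)[OF lim' this] w
      show "\<exists>w\<in>test_pairs. sqrt (form_dist2 M P ?U w) + sqrt (form_dist2 M R ?U w) < \<epsilon>"
        by (auto simp: eventually_sequentially)
    qed
  qed
next
  case False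
  then have "(u, g) \<notin> QH0 v Q \<Omega>" by (auto simp: QH0_def)
  moreover have "\<not> in_closure M P R test_pairs (\<lambda>x. (u x, g x))"
    using False pair_in_form_L2[of u g] by (auto simp: in_closure_def)
  ultimately show ?thesis by simp
qed

end

section \<open>The linear functional of the Dirichlet problem\<close>

locale dirichlet_data = weighted_domain \<Omega> v Q
  for \<Omega> :: "(real^'n) set" and v :: "real^'n \<Rightarrow> real" and Q :: "real^'n \<Rightarrow> real^'n^'n" +
  fixes C :: real and f h :: "real^'n \<Rightarrow> real" and e :: "real^'n \<Rightarrow> real^'n"
  assumes C_pos: "C > 0"
    and sobolev: "\<And>\<phi> G. \<lbrakk>\<phi> \<in> Lip0 \<Omega>; ae_gradient \<Omega> \<phi> G\<rbrakk> \<Longrightarrow>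
                     norm_L2 v \<Omega> \<phi> \<le> ennreal C * norm_QL2 Q \<Omega> G"
    and f: "f \<in> L2 v \<Omega>" and h: "h \<in> L2 v \<Omega>"
    and e_measurable: "e \<in> borel_measurable (lebesgue_on \<Omega>)"
    and e_bound: "AE x in lebesgue_on \<Omega>. \<forall>\<xi>. (e x \<bullet> \<xi>)\<^sup>2 \<le> inverse (v x) * ((Q x *v \<xi>) \<bullet> \<xi>)"
begin

lemma test_pairs_sobolev:
  assumes "w \<in> test_pairs"
  shows "form_inner M P w w \<le> C\<^sup>2 * form_inner M R w w"
proof -
  obtain \<phi> G where w: "w = (\<lambda>x. (\<phi> x, G x))" "(\<phi>, G) \<in> QLip0_pairs v Q \<Omega>"
    using assms by (auto simp: test_pairs_def)
  have L2: "(\<lambda>x. (\<phi> x, G x)) \<in> form_L2 M P" "(\<lambda>x. (\<phi> x, G x)) \<in> form_L2 M R"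
    using w(2) by (auto simp: QLip0_pairs_iff)
  have "norm_L2 v \<Omega> \<phi> \<le> ennreal C * norm_QL2 Q \<Omega> G"
    using w(2) by (intro sobolev) (auto simp: QLip0_pairs_iff)
  then have "ennreal (sqrt (form_inner M P w w)) \<le> ennreal (C * sqrt (form_inner M R w w))"
    using C_pos R.form_inner_nonneg[of w]
    by (simp add: norm_L2_eq[OF L2(1)] norm_QL2_eq[OF L2(2)] w(1) ennreal_mult)
  then have "sqrt (form_inner M P w w) \<le> C * sqrt (form_inner M R w w)"
    using C_pos R.form_inner_nonneg[of w] by (subst (asm) ennreal_le_iff) auto
  then have "(sqrt (form_inner M P w w))\<^sup>2 \<le> (C * sqrt (form_inner M R w w))\<^sup>2"
    using P.form_inner_nonneg[of w] by (intro power_mono) auto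
  then show ?thesis
    using P.form_inner_nonneg[of w] R.form_inner_nonneg[of w] by (simp add: power_mult_distrib)
qed

lemma L2_form_L2: "u \<in> L2 v \<Omega> \<Longrightarrow> (\<lambda>x. (u x, 0)) \<in> form_L2 M P"
  by (subst pair_form_L2_iff) (auto simp: L2_def)

text \<open>
  The arithmetic-geometric mean inequality for \<open>|h'| \<surd>vx\<close> and \<open>|e' \<bullet> \<xi>| \<surd>vx\<close>.
\<close>
lemma drift_pointwise:
  assumes "0 < vx" and "(e' \<bullet> \<xi>)\<^sup>2 \<le> inverse vx * q"
  shows "2 * \<bar>h' * (e' \<bullet> \<xi>) * vx\<bar> \<le> vx * h' * h' + q"
proof -
  have "(e' \<bullet> \<xi>)\<^sup>2 * vx \<le> q" using assms by (simp add: field_simps)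
  moreover have "0 \<le> vx * (\<bar>h'\<bar> - \<bar>e' \<bullet> \<xi>\<bar>)\<^sup>2" using assms(1) by simp
  ultimately show ?thesis
    using assms(1) by (simp add: power2_diff abs_mult power2_eq_square algebra_simps)
qed

lemma drift_term:
  assumes w: "w \<in> form_L2 M R"
  shows "integrable M (\<lambda>x. h x * (e x \<bullet> snd (w x)) * v x)"
    and "2 * \<bar>LINT x|M. h x * (e x \<bullet> snd (w x)) * v x\<bar>
      \<le> form_inner M P (\<lambda>x. (h x, 0)) (\<lambda>x. (h x, 0)) + form_inner M R w w"
proof -
  let ?h = "\<lambda>x. (h x, 0 :: real^'n)"
  let ?I = "\<lambda>x. h x * (e x \<bullet> snd (w x)) * v x"
  have [measurable]: "h \<in> borel_measurable M" "e \<in> borel_measurable M"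
    using h e_measurable by (auto simp: L2_def)
  have "(snd :: real \<times> (real^'n) \<Rightarrow> real^'n) \<in> borel_measurable borel"
    by (intro borel_measurable_continuous_onI continuous_intros)
  from measurable_compose[OF R.form_L2_measurable[OF w] this]
  have [measurable]: "(\<lambda>x. snd (w x)) \<in> borel_measurable M" .
  have bound: "AE x in M. 2 * \<bar>?I x\<bar> \<le> P x (?h x) (?h x) + R x (w x) (w x)"
    using v_pos e_bound
  proof eventually_elim
    case (elim x)
    then show ?case
      using drift_pointwise[OF elim(1), of "e x" "snd (w x)" _ "h x"]
      by (simp add: weight_form_def matrix_form_def)
  qed
  have hw: "integrable M (\<lambda>x. P x (?h x) (?h x))" "integrable M (\<lambda>x. R x (w x) (w x))"
    using P.integrable_form L2_form_L2[OF h] R.integrable_form w by blast+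
  have "integrable M (\<lambda>x. 2 * ?I x)"
  proof (rule Bochner_Integration.integrable_bound)
    show "integrable M (\<lambda>x. P x (?h x) (?h x) + R x (w x) (w x))" using hw by simp
    show "AE x in M. norm (2 * ?I x) \<le> norm (P x (?h x) (?h x) + R x (w x) (w x))"
      using bound by eventually_elim (simp add: abs_mult)
  qed measurable
  then show int: "integrable M ?I" by simp
  have int2: "integrable M (\<lambda>x. \<bar>2 * ?I x\<bar>)"
    using int by (intro integrable_abs integrable_mult_right)
  have "2 * \<bar>LINT x|M. ?I x\<bar> = \<bar>LINT x|M. 2 * ?I x\<bar>" by (simp add: abs_mult)
  also have "\<dots> \<le> (LINT x|M. \<bar>2 * ?I x\<bar>)" by (rule integral_abs_bound)
  also have "\<dots> \<le> (LINT x|M. P x (?h x) (?h x) + R x (w x) (w x))"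
  proof (rule integral_mono_AE[OF int2])
    show "AE x in M. \<bar>2 * ?I x\<bar> \<le> P x (?h x) (?h x) + R x (w x) (w x)"
      using bound by eventually_elim (simp add: abs_mult)
  qed (use hw in simp)
  finally show "2 * \<bar>LINT x|M. ?I x\<bar> \<le> form_inner M P ?h ?h + form_inner M R w w"
    using hw by (simp add: form_inner_def)
qed

text \<open>
  The right-hand side of the weak formulation. The term \<open>\<integral> f \<phi> v\<close> is written as an inner product
  with \<open>(f, 0)\<close>, so that the general estimates for forms apply to it.
\<close>
definition load :: "(real^'n \<Rightarrow> real \<times> (real^'n)) \<Rightarrow> real" where
  "load w = form_inner M P (\<lambda>x. (f x, 0)) w - (LINT x|M. h x * (e x \<bullet> snd (w x)) * v x)"

lemma load_comb:
  assumes "w \<in> test_pairs" "z \<in> test_pairs"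
  shows "load (\<lambda>x. w x + c *\<^sub>R z x) = load w + c * load z"
proof -
  have wz: "w \<in> form_L2 M P" "z \<in> form_L2 M P" "w \<in> form_L2 M R" "z \<in> form_L2 M R"
    using assms test_pairs_form_L2 by auto
  have "form_inner M P (\<lambda>x. (f x, 0)) (\<lambda>x. w x + c *\<^sub>R z x) =
      form_inner M P (\<lambda>x. (f x, 0)) w + c * form_inner M P (\<lambda>x. (f x, 0)) z"
    using P.form_inner_comb[OF wz(1,2) L2_form_L2[OF f]] P.form_inner_sym by metis
  moreover have "(LINT x|M. h x * (e x \<bullet> snd (w x + c *\<^sub>R z x)) * v x) =
      (LINT x|M. h x * (e x \<bullet> snd (w x)) * v x + c * (h x * (e x \<bullet> snd (z x)) * v x))"
    by (simp add: inner_add_right algebra_simps)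
  ultimately show ?thesis
    using drift_term(1)[OF wz(3)] drift_term(1)[OF wz(4)]
    by (simp add: load_def algebra_simps)
qed

lemma load_bound:
  obtains A where "\<And>w. w \<in> test_pairs \<Longrightarrow> \<bar>load w\<bar> \<le> A + (C\<^sup>2 + 1) / 2 * form_inner M R w w"
proof (rule that)
  let ?f = "\<lambda>x. (f x, 0 :: real^'n)" and ?h = "\<lambda>x. (h x, 0 :: real^'n)"
  fix w assume w: "w \<in> test_pairs"
  then have wz: "w \<in> form_L2 M P" "w \<in> form_L2 M R" using test_pairs_form_L2 by auto
  have "2 * \<bar>load w\<bar> \<le> 2 * \<bar>form_inner M P ?f w\<bar>
      + 2 * \<bar>LINT x|M. h x * (e x \<bullet> snd (w x)) * v x\<bar>"
    unfolding load_def distrib_left[symmetric] by (intro mult_left_mono abs_triangle_ineq4) simp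
  also have "\<dots> \<le> form_inner M P ?f ?f + form_inner M P ?h ?h + (C\<^sup>2 + 1) * form_inner M R w w"
    using P.abs_form_inner_le[OF L2_form_L2[OF f] wz(1)] drift_term(2)[OF wz(2)]
      test_pairs_sobolev[OF w] unfolding distrib_right by linarith
  finally show "\<bar>load w\<bar> \<le> (form_inner M P ?f ?f + form_inner M P ?h ?h) / 2
      + (C\<^sup>2 + 1) / 2 * form_inner M R w w"
    by (simp add: field_simps)
qed

lemma degenerate_weak_solution_iff:
  "degenerate_weak_solution \<Omega> v Q f h e u g \<longleftrightarrow>
     in_closure M P R test_pairs (\<lambda>x. (u x, g x)) \<and>
     (\<forall>z\<in>test_pairs. form_inner M R (\<lambda>x. (u x, g x)) z = load z)"
proof -
  have *: "form_inner M P (\<lambda>x. (f x, 0)) (\<lambda>x. (\<phi> x, G x)) = (LINT x|M. f x * \<phi> x * v x)" for \<phi> G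
    by (simp add: form_inner_def weight_form_def ac_simps)
  show ?thesis
    unfolding degenerate_weak_solution_def QH0_iff_in_closure test_pairs_def
    by (simp add: load_def form_inner_def[of M R] matrix_form_def * split_beta)
qed

end

section \<open>Existence and uniqueness for the Dirichlet problem\<close>

theorem theorem1p1:
  fixes \<Omega> :: "(real^'n) set"
    and v f h :: "real^'n \<Rightarrow> real"
    and Q :: "real^'n \<Rightarrow> real^'n^'n"
    and e :: "real^'n \<Rightarrow> real^'n"
    and C :: real
  assumes "open \<Omega>" and "bounded \<Omega>" and "connected \<Omega>"
    and "weight \<Omega> v" and "matrix_function \<Omega> Q"
    and nontrivial: "\<exists>(\<phi>, G) \<in> QLip0_pairs v Q \<Omega>. \<exists>x\<in>\<Omega>. \<phi> x \<noteq> 0"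
    and "C > 0"
    and sobolev: "\<And>\<phi> G. \<lbrakk>\<phi> \<in> Lip0 \<Omega>; ae_gradient \<Omega> \<phi> G\<rbrakk> \<Longrightarrow>
                     norm_L2 v \<Omega> \<phi> \<le> ennreal C * norm_QL2 Q \<Omega> G"
    and "f \<in> L2 v \<Omega>" and "h \<in> L2 v \<Omega>"
    and "e \<in> borel_measurable (lebesgue_on \<Omega>)"
    and "AE x in lebesgue_on \<Omega>. \<forall>\<xi>. (e x \<bullet> \<xi>)\<^sup>2 \<le> inverse (v x) * ((Q x *v \<xi>) \<bullet> \<xi>)"
  shows "\<exists>u g. degenerate_weak_solution \<Omega> v Q f h e u g \<and>
           (\<integral>\<^sup>+ x. ennreal (\<bar>u x\<bar>\<^sup>2 * v x) \<partial>lebesgue_on \<Omega>)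
             + (\<integral>\<^sup>+ x. ennreal ((norm (matrix_sqrt (Q x) *v g x))\<^sup>2) \<partial>lebesgue_on \<Omega>) < \<infinity> \<and>
           (\<forall>u' g'. degenerate_weak_solution \<Omega> v Q f h e u' g' \<longrightarrow>
              (AE x in lebesgue_on \<Omega>. u' x = u x \<and> g' x = g x))"
proof -
  interpret dirichlet_data \<Omega> v Q C f h e
    using assms by unfold_locales auto
  obtain A where A: "\<And>w. w \<in> test_pairs \<Longrightarrow> \<bar>load w\<bar> \<le> A + (C\<^sup>2 + 1) / 2 * form_inner M R w w"
    using load_bound by blast
  have "test_pairs \<noteq> {}" using zero_test_pair by blast
  moreover have "0 < (C\<^sup>2 + 1) / 2" by (simp add: add_nonneg_pos)
  ultimately obtain U where U: "in_closure M P R test_pairs U"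
      "\<And>z. z \<in> test_pairs \<Longrightarrow> form_inner M R U z = load z"
    using weak_solution_exists[OF P_form R_form form_posdef test_pairs_form_L2 _ test_pairs_comb
        load_comb test_pairs_sobolev A zero_le_power2]
    by metis
  define u where "u = (\<lambda>x. fst (U x))"
  define g where "g = (\<lambda>x. snd (U x))"
  have ug: "(\<lambda>x. (u x, g x)) = U" by (simp add: u_def g_def)
  have sol: "degenerate_weak_solution \<Omega> v Q f h e u g"
    using U by (simp add: degenerate_weak_solution_iff ug)
  have L2: "U \<in> form_L2 M P" "U \<in> form_L2 M R" using U(1) by (auto simp: in_closure_def)
  have "(\<integral>\<^sup>+ x. ennreal (\<bar>u x\<bar>\<^sup>2 * v x) \<partial>M) +
      (\<integral>\<^sup>+ x. ennreal ((norm (matrix_sqrt (Q x) *v g x))\<^sup>2) \<partial>M) < \<infinity>"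
    unfolding nn_integral_weight[of u g] nn_integral_matrix_sqrt[of g u]
    using P.nn_integral_form[OF L2(1)] R.nn_integral_form[OF L2(2)]
    by (simp add: u_def g_def flip: ennreal_plus add: P.form_inner_nonneg R.form_inner_nonneg)
  moreover have "AE x in M. u' x = u x \<and> g' x = g x"
    if "degenerate_weak_solution \<Omega> v Q f h e u' g'" for u' g'
  proof -
    have "AE x in M. (u' x, g' x) = U x"
      using that U unfolding degenerate_weak_solution_iff
      by (intro weak_solution_unique[OF P_form R_form form_posdef test_pairs_form_L2
            test_pairs_comb test_pairs_sobolev, where F = load]) blast+
    then show ?thesis by eventually_elim (metis u_def g_def fst_conv snd_conv)
  qed
  ultimately show ?thesis using sol by blast
qed

end
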